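(* Let $F$ be a field and let $f\colon\mathbb{N}\to\mathbb{N}$ be an increasing, submultiplicative function. Then there exists a finitely generated $F$-algebra $A$ whose growth function satisfies $f(n)\preceq\gamma_A(n)\preceq nf(n)$.
   Context: $\mathbb{N}=\{1,2,3,\dots\}$. A function $f\colon\mathbb{N}\to\mathbb{N}$ is increasing if $f(n)<f(n+1)$ for all $n$, and submultiplicative if $f(n+m)\le f(n)f(m)$ for all $n,m$. For functions $f,g$ on $\mathbb{N}$, $f\preceq g$ means that there is $C\in\mathbb{N}$ with $f(n)\le g(Cn)$ for all $n\in\mathbb{N}$; $f\sim g$ means $f\preceq g$ and $g\preceq f$. Algebras are associative. For a finitely generated $F$-algebra $A$ with finite-dimensional generating subspace $V$, $\gamma_{A,V}(n)=\dim_F(F+V+V^2+\cdots+V^n)$; $\gamma_A$ denotes this function for some choice of $V$ (it is independent of $V$ up to $\sim$). *)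

theory Defs
  imports "Jordan_Normal_Form.Missing_VectorSpace"
begin

text \<open>
  Positive integers are modelled by \<^typ>\<open>nat\<close> with guards \<open>n \<ge> 1\<close>; values at \<open>0\<close>
  are never constrained or used.
\<close>

definition pos_valued :: "(nat \<Rightarrow> nat) \<Rightarrow> bool" where
  "pos_valued f \<longleftrightarrow> (\<forall>n\<ge>1. f n \<ge> 1)"

definition increasing :: "(nat \<Rightarrow> nat) \<Rightarrow> bool" where
  "increasing f \<longleftrightarrow> (\<forall>n\<ge>1. f n < f (n + 1))"

definition submultiplicative :: "(nat \<Rightarrow> nat) \<Rightarrow> bool" where
  "submultiplicative f \<longleftrightarrow> (\<forall>n\<ge>1. \<forall>m\<ge>1. f (n + m) \<le> f n * f m)"

definition growth_le :: "(nat \<Rightarrow> nat) \<Rightarrow> (nat \<Rightarrow> nat) \<Rightarrow> bool" (infix \<open>\<preceq>\<close> 50) where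
  "f \<preceq> g \<longleftrightarrow> (\<exists>C\<ge>1. \<forall>n\<ge>1. f n \<le> g (C * n))"

text \<open>
  Unital associative algebras over a field. The locale \<^locale>\<open>algebra\<close> of HOL-Algebra
  cannot be used, since it requires multiplication to be commutative.
\<close>

locale assoc_algebra = vectorspace F A + A?: ring A
  for F (structure) and A (structure) +
  assumes smult_mult_left:
      "\<lbrakk>a \<in> carrier F; x \<in> carrier A; y \<in> carrier A\<rbrakk>
        \<Longrightarrow> (a \<odot>\<^bsub>A\<^esub> x) \<otimes>\<^bsub>A\<^esub> y = a \<odot>\<^bsub>A\<^esub> (x \<otimes>\<^bsub>A\<^esub> y)"
    and smult_mult_right:
      "\<lbrakk>a \<in> carrier F; x \<in> carrier A; y \<in> carrier A\<rbrakk>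
        \<Longrightarrow> x \<otimes>\<^bsub>A\<^esub> (a \<odot>\<^bsub>A\<^esub> y) = a \<odot>\<^bsub>A\<^esub> (x \<otimes>\<^bsub>A\<^esub> y)"
begin

definition unital_subalgebra :: "'c set \<Rightarrow> bool" where
  "unital_subalgebra B \<longleftrightarrow>
     subspace F B A \<and> \<one>\<^bsub>A\<^esub> \<in> B \<and> (\<forall>x\<in>B. \<forall>y\<in>B. x \<otimes>\<^bsub>A\<^esub> y \<in> B)"

definition generates_algebra :: "'c set \<Rightarrow> bool" where
  "generates_algebra S \<longleftrightarrow>
     S \<subseteq> carrier A \<and> (\<forall>B. unital_subalgebra B \<and> S \<subseteq> B \<longrightarrow> B = carrier A)"

definition finitely_generated :: bool where
  "finitely_generated \<longleftrightarrow> (\<exists>S. finite S \<and> generates_algebra S)"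

definition generating_subspace :: "'c set \<Rightarrow> bool" where
  "generating_subspace V \<longleftrightarrow>
     subspace F V A \<and> vectorspace.fin_dim F (vs V) \<and> generates_algebra V"

definition subspace_prod :: "'c set \<Rightarrow> 'c set \<Rightarrow> 'c set" where
  "subspace_prod U W = span {x \<otimes>\<^bsub>A\<^esub> y | x y. x \<in> U \<and> y \<in> W}"

primrec subspace_power :: "'c set \<Rightarrow> nat \<Rightarrow> 'c set" where
  "subspace_power V 0 = span {\<one>\<^bsub>A\<^esub>}"
| "subspace_power V (Suc n) = subspace_prod (subspace_power V n) V"

text \<open>The subspace \<open>F + V + V\<^sup>2 + \<dots> + V\<^sup>n\<close>, where \<open>F\<close> stands for \<open>F \<cdot> 1 = V\<^sup>0\<close>.\<close>

primrec filtration :: "'c set \<Rightarrow> nat \<Rightarrow> 'c set" where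
  "filtration V 0 = subspace_power V 0"
| "filtration V (Suc n) = subspace_sum (filtration V n) (subspace_power V (Suc n))"

definition growth :: "'c set \<Rightarrow> nat \<Rightarrow> nat" where
  "growth V n = vectorspace.dim F (vs (filtration V n))"

end

text \<open>
  HOL cannot quantify existentially over types, so an existence statement about algebras
  has to fix the type of their elements. The type below loses no generality: a finitely
  generated \<open>F\<close>-algebra has a countable basis, hence is isomorphic to one whose
  elements are finitely supported functions from words over \<^typ>\<open>nat\<close> to \<open>F\<close>.
\<close>

type_synonym 'a word_algebra = "('a, nat list \<Rightarrow> 'a) module"

end

theory Submission
  imports Defs
begin

text \<open>
  The algebra is a monomial algebra: its basis is a factor-closed language \<open>L\<close> over
  \<open>{0, 1}\<close>, and a product of two basis words is their concatenation if that lies in \<open>L\<close>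
  and \<open>0\<close> otherwise. The growth of such an algebra is, up to rescaling the argument, the number
  \<open>T n\<close> of words of \<open>L\<close> of length at most \<open>n\<close>, whichever generating subspace is used
  (\<open>growth_bounds\<close>). What remains is a counting problem: find \<open>L\<close> with
  \<open>f n \<le> T (C * n)\<close> and \<open>T n \<le> C * n * f (C * n)\<close>.

  A word is written as \<open>0\<^sup>a 1 0\<^bsup>x\<^sub>1\<^esup> 1 \<dots> 1 0\<^sup>b\<close>, and its information is stored
  in the gaps \<open>x\<^sub>i\<close>. For each scale \<open>N = 2\<^sup>k\<close> the language contains the words of
  length \<open>O(N)\<close> having at most \<open>r\<close> gaps, all of them in \<open>{n..<2 * n}\<close>, where
  \<open>n \<approx> f 1 * N / r\<close>; to these are added all
  words with at most one letter \<open>1\<close>, the sparse words, of which only \<open>O(m\<^sup>2)\<close> have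
  length at most \<open>m\<close>.
  The two outer blocks of zeros alone account for a factor \<open>N\<^sup>2\<close>, so stage \<open>k\<close> contains
  at least \<open>N\<^sup>2 * n ^ r\<close> words, and \<open>r\<close> is the least number for which this is at least
  \<open>f N\<close>. That gives the lower bound (\<open>f_le_card_words\<close>).

  For the upper bound, fix a length \<open>m\<close>. Minimality of \<open>r\<close> gives
  \<open>N * n ^ r \<le> f 1 * f N\<close>, so stage \<open>k\<close> has \<open>O(N * f N)\<close> words in total, and the stages
  with \<open>N \<le> 40 * m\<close> contribute a geometric sum of order \<open>m * f (40 * m)\<close>. A later stage can
  contribute a word of length \<open>m\<close> that is not sparse only if \<open>n \<le> m\<close>, because a window
  shorter than the gaps sees at most one letter \<open>1\<close>. The window then sees at most
  \<open>m div n\<close> gaps, so it is one of at most \<open>n ^ (5 * (m div n + 1))\<close> words.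
  Submultiplicativity now enters: a stage with this \<open>n\<close> was
  needed only because \<open>f N\<close> is large, of the order of \<open>n ^ r\<close> up to a power, and
  \<open>f N \<le> f (40 * m) ^ q\<close> with \<open>q \<approx> N / (40 * m)\<close>
  forces \<open>f (40 * m)\<close> to be at least that number (\<open>min_gap_power_le\<close>). Stages with the same
  \<open>n\<close> share their short words, and there are at most \<open>m\<close> possible values of \<open>n\<close>, so the
  late stages together contribute at most \<open>m * f (40 * m)\<close> further words (\<open>card_words_upto_le\<close>).
\<close>

section \<open>Binary words with prescribed gaps\<close>

text \<open>
  \<open>pulse a [x\<^sub>1, \<dots>, x\<^sub>r] b\<close> is the word
  \<open>0\<^sup>a 1 0\<^bsup>x\<^sub>1\<^esup> 1 \<dots> 1 0\<^bsup>x\<^sub>r\<^esup> 1 0\<^sup>b\<close>. The recursion reuses the first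
  argument: once a \<open>1\<close> has been written, the next gap becomes the leading block of the rest.
\<close>

fun pulse :: "nat \<Rightarrow> nat list \<Rightarrow> nat \<Rightarrow> nat list" where
  "pulse a [] b = replicate a 0 @ 1 # replicate b 0"
| "pulse a (x # xs) b = replicate a 0 @ 1 # pulse x xs b"

lemma length_pulse: "length (pulse a xs b) = a + b + 1 + sum_list (map Suc xs)"
  by (induction xs arbitrary: a) auto

lemma pulse_snoc: "pulse a (xs @ [x]) b = pulse a xs x @ 1 # replicate b 0"
  by (induction xs arbitrary: a) auto

lemma rev_pulse: "rev (pulse a xs b) = pulse b (rev xs) a"
  by (induction xs arbitrary: a) (simp_all add: pulse_snoc)

lemma replicate_One_inject:
  assumes "replicate a (0::nat) @ 1 # u = replicate c 0 @ 1 # v"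
  shows "a = c \<and> u = v"
  using assms
proof (induction a arbitrary: c)
  case 0
  then show ?case by (cases c) auto
next
  case (Suc a)
  then show ?case by (cases c) auto
qed

lemma pulse_neq_replicate: "pulse a xs b \<noteq> replicate i 0"
proof
  assume "pulse a xs b = replicate i 0"
  moreover have "1 \<in> set (pulse a xs b)" by (cases xs) auto
  ultimately show False by auto
qed

text \<open>
  Distinct data give distinct words; this is what makes the lower bound on the number of words
  a product of independent choices.
\<close>

lemma pulse_inject: "pulse a xs b = pulse c ys d \<longleftrightarrow> a = c \<and> xs = ys \<and> b = d"
proof
  assume "pulse a xs b = pulse c ys d"
  then show "a = c \<and> xs = ys \<and> b = d"
  proof (induction xs arbitrary: a c ys)
    case Nil
    show ?case
    proof (cases ys)
      case Nil
      then have "replicate a 0 @ 1 # replicate b 0 = replicate c 0 @ 1 # replicate d (0::nat)"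
        using Nil.prems by simp
      then have "a = c" "replicate b (0::nat) = replicate d 0"
        using replicate_One_inject by blast+
      then show ?thesis using Nil by (metis length_replicate)
    next
      case (Cons y ys')
      then have "replicate a 0 @ 1 # replicate b 0 = replicate c 0 @ 1 # pulse y ys' d"
        using Nil.prems by simp
      then have "replicate b 0 = pulse y ys' d" using replicate_One_inject by blast
      then show ?thesis using pulse_neq_replicate by metis
    qed
  next
    case (Cons x xs)
    show ?case
    proof (cases ys)
      case Nil
      then show ?thesis
        using Cons.prems pulse_neq_replicate[of x xs b d]
          replicate_One_inject[of a "pulse x xs b" c "replicate d 0"] by simp
    next
      case (Cons y ys')
      then have "a = c \<and> pulse x xs b = pulse y ys' d"
        using Cons.prems replicate_One_inject[of a "pulse x xs b" c "pulse y ys' d"] by simp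
      then show ?thesis using Cons.IH[of x y ys'] Cons by auto
    qed
  qed
qed auto

definition gap_words :: "nat \<Rightarrow> nat \<Rightarrow> nat \<Rightarrow> nat list set" where
  "gap_words n r l = {pulse a xs b | a xs b.
     length xs \<le> r \<and> set xs \<subseteq> {n..<2 * n} \<and> length (pulse a xs b) \<le> l}"

text \<open>
  The words with at most one letter \<open>1\<close>. They are present at every length and absorb all
  factors in which no complete gap is visible.
\<close>

definition sparse_words :: "nat list set" where
  "sparse_words = range (\<lambda>i. replicate i 0) \<union> {pulse a [] b | a b. True}"

lemma tl_pulse:
  "(\<exists>j. tl (pulse a xs b) = replicate j 0) \<or>
   (\<exists>c ys. tl (pulse a xs b) = pulse c ys b \<and> set ys \<subseteq> set xs \<and> length ys \<le> length xs)"
proof (cases a)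
  case 0
  show ?thesis
  proof (cases xs)
    case (Cons x ys)
    then have "tl (pulse a xs b) = pulse x ys b" using 0 by simp
    then show ?thesis using Cons by (intro disjI2 exI[of _ x] exI[of _ ys]) auto
  qed (use 0 in auto)
next
  case (Suc a')
  then have "tl (pulse a xs b) = pulse a' xs b" by (cases xs) auto
  then show ?thesis by blast
qed

text \<open>
  A suffix of a pulse word either contains no \<open>1\<close> or is again a pulse word, whose gaps are
  among the old ones: what remains of the gap in which the cut falls is the new leading block of zeros.
\<close>

lemma drop_pulse:
  "(\<exists>j. drop i (pulse a xs b) = replicate j 0) \<or>
   (\<exists>c ys. drop i (pulse a xs b) = pulse c ys b \<and> set ys \<subseteq> set xs \<and> length ys \<le> length xs)"
proof (induction i)
  case 0
  then show ?case by auto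
next
  case (Suc i)
  have step: "drop (Suc i) (pulse a xs b) = tl (drop i (pulse a xs b))"
    by (simp add: drop_Suc tl_drop)
  from Suc show ?case
  proof
    assume "\<exists>j. drop i (pulse a xs b) = replicate j 0"
    then obtain j where "drop (Suc i) (pulse a xs b) = replicate (j - 1) 0"
      using step by (metis replicate_empty tl_replicate)
    then show ?case by blast
  next
    assume "\<exists>c ys. drop i (pulse a xs b) = pulse c ys b \<and> set ys \<subseteq> set xs \<and> length ys \<le> length xs"
    then obtain c ys where "drop i (pulse a xs b) = pulse c ys b"
      and "set ys \<subseteq> set xs" "length ys \<le> length xs" by blast
    then show ?case using step tl_pulse[of c ys b] by (metis order_trans)
  qed
qed

lemma suffix_gap_words:
  assumes "u @ v \<in> gap_words n r l"
  shows "v \<in> sparse_words \<union> gap_words n r l"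
proof -
  from assms obtain a xs b where w: "u @ v = pulse a xs b" "length xs \<le> r"
    "set xs \<subseteq> {n..<2 * n}" "length (pulse a xs b) \<le> l"
    unfolding gap_words_def by blast
  have v: "v = drop (length u) (pulse a xs b)"
    by (simp flip: w(1))
  have len: "length v \<le> l" using w(1,4) by (metis length_append add_leD2)
  from drop_pulse[of "length u" a xs b] show ?thesis
  proof
    assume "\<exists>j. drop (length u) (pulse a xs b) = replicate j 0"
    then show ?thesis unfolding v sparse_words_def by auto
  next
    assume "\<exists>c ys. drop (length u) (pulse a xs b) = pulse c ys b \<and> set ys \<subseteq> set xs \<and> length ys \<le> length xs"
    then obtain c ys where "v = pulse c ys b" "set ys \<subseteq> set xs" "length ys \<le> length xs"
      using v by metis
    then have "v \<in> gap_words n r l"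
      using w(2,3) len unfolding gap_words_def by fastforce
    then show ?thesis by simp
  qed
qed

lemma suffix_sparse_words:
  assumes "u @ v \<in> sparse_words"
  shows "v \<in> sparse_words"
proof -
  consider i where "u @ v = replicate i 0" | a b where "u @ v = pulse a [] b"
    using assms unfolding sparse_words_def by blast
  then show ?thesis
  proof cases
    case 1
    then have "v = replicate (length v) 0"
      by (metis append_eq_conv_conj drop_replicate length_replicate)
    then show ?thesis unfolding sparse_words_def by blast
  next
    case 2
    then have "u @ v \<in> gap_words 0 0 (length (pulse a [] b))"
      unfolding gap_words_def by fastforce
    from suffix_gap_words[OF this] show ?thesis
      unfolding sparse_words_def gap_words_def by auto
  qed
qed

lemma rev_gap_words: "w \<in> gap_words n r l \<Longrightarrow> rev w \<in> gap_words n r l"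
proof -
  assume "w \<in> gap_words n r l"
  then obtain a xs b where w: "w = pulse a xs b" "length xs \<le> r" "set xs \<subseteq> {n..<2 * n}"
    "length (pulse a xs b) \<le> l" unfolding gap_words_def by blast
  then have "rev w = pulse b (rev xs) a" "length (pulse b (rev xs) a) \<le> l"
    by (simp_all add: rev_pulse flip: length_rev[of "pulse a xs b"])
  moreover have "length (rev xs) \<le> r" "set (rev xs) \<subseteq> {n..<2 * n}" using w by auto
  ultimately show ?thesis unfolding gap_words_def by blast
qed

lemma rev_sparse_words: "w \<in> sparse_words \<Longrightarrow> rev w \<in> sparse_words"
proof -
  assume "w \<in> sparse_words"
  then consider i where "w = replicate i 0" | a b where "w = pulse a [] b"
    unfolding sparse_words_def by blast
  then show ?thesis
  proof cases
    case 2
    then have "rev w = pulse b [] a" using rev_pulse[of a "[]" b] by simp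
    then show ?thesis unfolding sparse_words_def by blast
  qed (auto simp: sparse_words_def)
qed

definition factor_closed :: "'b list set \<Rightarrow> bool" where
  "factor_closed L \<longleftrightarrow> (\<forall>u v. u @ v \<in> L \<longrightarrow> u \<in> L \<and> v \<in> L)"

text \<open>
  Closure under reversal turns statements about suffixes into statements about prefixes, so
  only suffixes of pulse words have to be analysed.
\<close>

lemma factor_closedI_rev:
  assumes "\<And>u v. u @ v \<in> L \<Longrightarrow> v \<in> L" and "\<And>w. w \<in> L \<Longrightarrow> rev w \<in> L"
  shows "factor_closed L"
  unfolding factor_closed_def
proof (intro allI impI conjI)
  fix u v assume uv: "u @ v \<in> L"
  show "v \<in> L" using assms(1)[OF uv] .
  have "rev v @ rev u \<in> L" using assms(2)[OF uv] by simp
  then have "rev u \<in> L" using assms(1) by blast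
  then show "u \<in> L" using assms(2) by fastforce
qed

definition pulse_language :: "(nat \<Rightarrow> nat) \<Rightarrow> (nat \<Rightarrow> nat) \<Rightarrow> (nat \<Rightarrow> nat) \<Rightarrow> nat list set" where
  "pulse_language n r l = sparse_words \<union> (\<Union>k. gap_words (n k) (r k) (l k))"

lemma factor_closed_pulse_language: "factor_closed (pulse_language n r l)"
  by (rule factor_closedI_rev)
    (auto simp: pulse_language_def dest: suffix_sparse_words suffix_gap_words
      rev_sparse_words rev_gap_words)

text \<open>
  The same words as in \<open>gap_words\<close>, but with independent bounds on the two outer blocks in
  place of a bound on the total length. Being the image of a product, this set can be counted.
\<close>

definition gap_box :: "nat \<Rightarrow> nat \<Rightarrow> nat \<Rightarrow> nat list set" where
  "gap_box p n s = (\<lambda>((a, b), xs). pulse a xs b) `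
     (({..<p} \<times> {..<p}) \<times> {xs. set xs \<subseteq> {n..<2 * n} \<and> length xs \<le> s})"

lemma geometric_le:
  assumes "2 \<le> n \<or> s = 0"
  shows "(\<Sum>i\<le>s. n ^ i) \<le> 2 * (n::nat) ^ s"
  using assms
proof (induction s)
  case (Suc s)
  then have "2 \<le> n" by simp
  then have "2 * n ^ s \<le> n ^ Suc s" by simp
  moreover have "(\<Sum>i\<le>s. n ^ i) \<le> 2 * n ^ s" using Suc by auto
  moreover have "(\<Sum>i\<le>Suc s. n ^ i) = (\<Sum>i\<le>s. n ^ i) + n ^ Suc s" by simp
  ultimately show ?case by linarith
qed simp

lemma finite_gap_box: "finite (gap_box p n s)"
  unfolding gap_box_def by (intro finite_imageI finite_cartesian_product finite_lists_length_le) auto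

text \<open>
  The number of gaps is at most \<open>s\<close>, not exactly \<open>s\<close>; the geometric sum over the number of gaps
  costs only a factor \<open>2\<close> since \<open>n \<ge> 2\<close>.
\<close>

lemma card_gap_box_le:
  assumes "2 \<le> n \<or> s = 0"
  shows "card (gap_box p n s) \<le> 2 * p\<^sup>2 * n ^ s"
proof -
  have "card (gap_box p n s) \<le> card (({..<p} \<times> {..<p}) \<times> {xs. set xs \<subseteq> {n..<2 * n} \<and> length xs \<le> s})"
    unfolding gap_box_def
    by (intro card_image_le finite_cartesian_product finite_lists_length_le) auto
  also have "\<dots> = p\<^sup>2 * (\<Sum>i\<le>s. n ^ i)"
    by (simp add: card_lists_length_le card_cartesian_product power2_eq_square)
  also have "\<dots> \<le> p\<^sup>2 * (2 * n ^ s)"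
    using geometric_le[OF assms] by (rule mult_left_mono) simp
  finally show ?thesis by (simp add: mult.assoc mult.left_commute)
qed

lemma gap_words_subset_gap_box: "gap_words n r l \<subseteq> gap_box l n r"
proof
  fix w assume "w \<in> gap_words n r l"
  then obtain a xs b where "w = pulse a xs b" "length xs \<le> r" "set xs \<subseteq> {n..<2 * n}"
    "length (pulse a xs b) \<le> l" unfolding gap_words_def by blast
  then show "w \<in> gap_box l n r"
    unfolding gap_box_def by (intro image_eqI[of _ _ "((a, b), xs)"]) (auto simp: length_pulse)
qed

text \<open>
  A word of length at most \<open>m\<close> has room for only \<open>m div n\<close> gaps of size at least \<open>n\<close>. The
  bound involves neither \<open>r\<close> nor \<open>l\<close>, hence is common to all stages with minimal gap \<open>n\<close>.
\<close>

lemma short_gap_word_in_gap_box: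
  assumes "w \<in> gap_words n r l" and "length w \<le> m" and "0 < n"
  shows "w \<in> gap_box m n (m div n)"
proof -
  obtain a xs b where w: "w = pulse a xs b" "set xs \<subseteq> {n..<2 * n}"
    using assms(1) unfolding gap_words_def by blast
  have "length xs * n \<le> sum_list (map Suc xs)"
    using w(2) by (induction xs) auto
  also have "\<dots> \<le> m" using assms(2) w(1) by (simp add: length_pulse)
  finally have "length xs \<le> m div n"
    using assms(3) by (simp add: less_eq_div_iff_mult_less_eq)
  then show ?thesis using w assms(2)
    unfolding gap_box_def by (intro image_eqI[of _ _ "((a, b), xs)"]) (auto simp: length_pulse)
qed

lemma short_gap_word_sparse:
  assumes "w \<in> gap_words n r l" and "length w \<le> m" and "m < n \<or> r = 0"
  shows "w \<in> sparse_words"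
proof -
  obtain a xs b where w: "w = pulse a xs b" "set xs \<subseteq> {n..<2 * n}" "length xs \<le> r"
    using assms(1) unfolding gap_words_def by blast
  have "xs = []"
  proof (cases xs)
    case (Cons x ys)
    then have "n \<le> x" "x < length w" "r \<noteq> 0" using w by (auto simp: length_pulse)
    then show ?thesis using assms by auto
  qed
  then show ?thesis using w(1) unfolding sparse_words_def by blast
qed

lemma finite_card_sparse_words:
  assumes "1 \<le> m"
  shows "finite {w \<in> sparse_words. length w \<le> m}"
    and "card {w \<in> sparse_words. length w \<le> m} \<le> 4 * m\<^sup>2"
proof -
  let ?Z = "(\<lambda>i. replicate i (0::nat)) ` {..m}"
  have sub: "{w \<in> sparse_words. length w \<le> m} \<subseteq> ?Z \<union> gap_box m 0 0"
  proof
    fix w assume "w \<in> {w \<in> sparse_words. length w \<le> m}"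
    then consider i where "w = replicate i 0" "i \<le> m" | a b where "w = pulse a [] b" "a + b < m"
      unfolding sparse_words_def by (auto simp: length_pulse)
    then show "w \<in> ?Z \<union> gap_box m 0 0"
    proof cases
      case 2
      then show ?thesis unfolding gap_box_def
        by (intro UnI2 image_eqI[of _ _ "((a, b), [])"]) auto
    qed auto
  qed
  have fin: "finite (?Z \<union> gap_box m 0 0)" by (simp add: finite_gap_box)
  show "finite {w \<in> sparse_words. length w \<le> m}" using finite_subset[OF sub fin] .
  have "card {w \<in> sparse_words. length w \<le> m} \<le> card (?Z \<union> gap_box m 0 0)"
    by (rule card_mono[OF fin sub])
  also have "\<dots> \<le> card ?Z + card (gap_box m 0 0)" by (rule card_Un_le)
  also have "\<dots> \<le> Suc m + 2 * m\<^sup>2"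
    using card_image_le[of "{..m}" "\<lambda>i. replicate i (0::nat)"] card_gap_box_le[of 0 0 m] by simp
  also have "\<dots> \<le> 4 * m\<^sup>2"
  proof -
    have "m \<le> m\<^sup>2" "1 \<le> m\<^sup>2" using assms by (auto simp: power2_eq_square)
    then show ?thesis by linarith
  qed
  finally show "card {w \<in> sparse_words. length w \<le> m} \<le> 4 * m\<^sup>2" .
qed

lemma finite_gap_words: "finite (gap_words n r l)"
  using finite_subset[OF gap_words_subset_gap_box finite_gap_box] .

text \<open>
  Words with exactly \<open>r\<close> gaps and outer blocks shorter than \<open>p\<close> are short enough to belong to
  \<open>gap_words n r l\<close>, and all their parameters can be chosen independently.
\<close>

lemma card_gap_words_ge:
  assumes "2 * p + 2 * n * r \<le> l" and "1 \<le> n \<or> r = 0"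
  shows "p\<^sup>2 * n ^ r \<le> card (gap_words n r l)"
proof -
  let ?P = "({..<p} \<times> {..<p}) \<times> {xs. set xs \<subseteq> {n..<2 * n} \<and> length xs = r}"
  let ?g = "\<lambda>((a, b), xs). pulse a xs b"
  have inj: "inj_on ?g ?P" by (auto simp: inj_on_def pulse_inject)
  have "?g ` ?P \<subseteq> gap_words n r l"
  proof clarify
    fix a b xs assume *: "a < p" "b < p" "set xs \<subseteq> {n..<2 * n}" "r = length xs"
    have "sum_list (map Suc xs) \<le> 2 * n * length xs"
      using *(3) by (induction xs) auto
    with * assms(1) have "length (pulse a xs b) \<le> l"
      by (simp add: length_pulse)
    then show "pulse a xs b \<in> gap_words n (length xs) l"
      using * unfolding gap_words_def by blast
  qed
  then have "card (?g ` ?P) \<le> card (gap_words n r l)"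
    by (rule card_mono[OF finite_gap_words])
  then have le: "card ?P \<le> card (gap_words n r l)"
    unfolding card_image[OF inj] .
  have "card {xs. set xs \<subseteq> {n..<2 * n} \<and> length xs = r} = n ^ r"
    by (subst card_lists_length_eq) simp_all
  then show ?thesis using le unfolding card_cartesian_product power2_eq_square
    by (simp only: card_lessThan)
qed

section \<open>The language attached to a submultiplicative function\<close>

locale submultiplicative_growth =
  fixes f :: "nat \<Rightarrow> nat"
  assumes f_pos: "\<And>n. 1 \<le> n \<Longrightarrow> 1 \<le> f n"
    and f_Suc: "\<And>n. 1 \<le> n \<Longrightarrow> f n < f (Suc n)"
    and f_add: "\<And>m n. 1 \<le> m \<Longrightarrow> 1 \<le> n \<Longrightarrow> f (m + n) \<le> f m * f n"
begin

lemma f_mono: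
  assumes "1 \<le> m" "m \<le> n"
  shows "f m \<le> f n"
  using assms(2)
proof (induction n rule: dec_induct)
  case (step n)
  then show ?case using f_Suc[of n] assms(1) by simp
qed simp

lemma f_ge_self: "1 \<le> n \<Longrightarrow> n \<le> f n"
proof (induction n rule: dec_induct)
  case base
  then show ?case using f_pos by simp
next
  case (step n)
  then show ?case using f_Suc[of n] by simp
qed

lemma f_mult_le:
  assumes "1 \<le> m" "1 \<le> q"
  shows "f (m * q) \<le> f m ^ q"
  using assms(2)
proof (induction q rule: dec_induct)
  case (step q)
  have "f (m + m * q) \<le> f m * f (m * q)" using assms(1) step by (intro f_add) auto
  also have "\<dots> \<le> f m * f m ^ q" using step by simp
  finally show ?case by simp
qed simp

lemma f1_ge_2: "2 \<le> f 1"
proof (rule ccontr)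
  assume "\<not> 2 \<le> f 1"
  then have "f 1 = 1" using f_pos[of 1] by simp
  then show False using f_add[of 1 1] f_Suc[of 1] by (simp add: numeral_2_eq_2)
qed

text \<open>
  The least number \<open>r\<close> of gaps for which the words at scale \<open>N = 2\<^sup>k\<close> are numerous enough. More
  gaps have to be smaller in order to fit into length \<open>O(N)\<close>, which is why the minimal gap is
  \<open>f 1 * N div r\<close>. If \<open>f N \<le> N\<^sup>2\<close> the value is \<open>0\<close>: then \<open>f 1 * N div 0 = 0\<close>, no
  gaps are used, and the formula evaluates correctly because \<open>0 ^ 0 = 1\<close>.
\<close>

definition max_gaps :: "nat \<Rightarrow> nat" where
  "max_gaps k = (LEAST r. f (2 ^ k) \<le> (2 ^ k)\<^sup>2 * (f 1 * 2 ^ k div r) ^ r)"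

definition min_gap :: "nat \<Rightarrow> nat" where
  "min_gap k = f 1 * 2 ^ k div max_gaps k"

text \<open>
  With \<open>N\<close> gaps of size about \<open>f 1\<close> there are at least \<open>f 1 ^ N\<close> words, and
  \<open>f N \<le> f 1 ^ N\<close> by submultiplicativity.
\<close>

lemma max_gaps_witness: "f (2 ^ k) \<le> (2 ^ k)\<^sup>2 * (f 1 * 2 ^ k div 2 ^ k) ^ (2 ^ k)"
proof -
  have "f (2 ^ k) \<le> f 1 ^ (2 ^ k)" using f_mult_le[of 1 "2 ^ k"] by simp
  also have "\<dots> \<le> (2 ^ k)\<^sup>2 * f 1 ^ (2 ^ k)" by simp
  finally show ?thesis by simp
qed

lemma max_gaps_spec: "f (2 ^ k) \<le> (2 ^ k)\<^sup>2 * min_gap k ^ max_gaps k"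
  unfolding min_gap_def max_gaps_def by (rule LeastI[of _ "2 ^ k"], rule max_gaps_witness)

lemma max_gaps_le: "max_gaps k \<le> 2 ^ k"
  unfolding max_gaps_def by (rule Least_le, rule max_gaps_witness)

lemma min_gap_ge_2:
  assumes "0 < max_gaps k"
  shows "2 \<le> min_gap k"
proof -
  have "2 * max_gaps k \<le> f 1 * 2 ^ k" using f1_ge_2 max_gaps_le by (rule mult_le_mono)
  then show ?thesis using assms by (simp add: min_gap_def less_eq_div_iff_mult_less_eq)
qed

lemma min_gap_mult_max_gaps_le: "min_gap k * max_gaps k \<le> f 1 * 2 ^ k"
  unfolding min_gap_def by (rule div_times_less_eq_dividend)

lemma min_gap_mult_max_gaps_ge:
  assumes "0 < max_gaps k"
  shows "f 1 * 2 ^ k < 2 * min_gap k * max_gaps k"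
proof -
  have "f 1 * 2 ^ k < min_gap k * max_gaps k + max_gaps k"
    using mod_less_divisor[OF assms, of "f 1 * 2 ^ k"] div_mult_mod_eq[of "f 1 * 2 ^ k" "max_gaps k"]
    unfolding min_gap_def by linarith
  also have "\<dots> \<le> 2 * min_gap k * max_gaps k"
  proof -
    have "1 * max_gaps k \<le> min_gap k * max_gaps k" using min_gap_ge_2[OF assms] by (intro mult_le_mono1) simp
    then show ?thesis by simp
  qed
  finally show ?thesis .
qed

text \<open>
  One gap fewer would not suffice, and it would not make the minimal gap smaller.
\<close>

lemma max_gaps_minimal:
  assumes "0 < max_gaps k"
  shows "(2 ^ k)\<^sup>2 * min_gap k ^ (max_gaps k - 1) < f (2 ^ k)"
proof -
  have "\<not> f (2 ^ k) \<le> (2 ^ k)\<^sup>2 * (f 1 * 2 ^ k div (max_gaps k - 1)) ^ (max_gaps k - 1)"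
    using assms unfolding max_gaps_def by (intro not_less_Least) simp
  moreover have "min_gap k ^ (max_gaps k - 1) \<le> (f 1 * 2 ^ k div (max_gaps k - 1)) ^ (max_gaps k - 1)"
  proof (cases "max_gaps k - 1 = 0")
    case False
    then show ?thesis unfolding min_gap_def by (intro power_mono div_le_mono2) auto
  qed simp
  then have "(2 ^ k)\<^sup>2 * min_gap k ^ (max_gaps k - 1)
      \<le> (2 ^ k)\<^sup>2 * (f 1 * 2 ^ k div (max_gaps k - 1)) ^ (max_gaps k - 1)" by simp
  ultimately show ?thesis by linarith
qed

text \<open>
  Minimality compares \<open>f N\<close> with \<open>N\<^sup>2 * n ^ (r - 1)\<close>. Restoring the missing factor \<open>n\<close>,
  which is at most \<open>f 1 * N\<close>, uses up one factor \<open>N\<close>; this is where the factor \<open>n\<close> in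
  the bound \<open>n * f n\<close> is spent.
\<close>

lemma min_gap_power_max_gaps_le: "2 ^ k * min_gap k ^ max_gaps k \<le> f 1 * f (2 ^ k)"
proof (cases "max_gaps k = 0")
  case True
  then have "2 ^ k * min_gap k ^ max_gaps k \<le> f (2 ^ k)" using f_ge_self[of "2 ^ k"] by simp
  also have "\<dots> \<le> f 1 * f (2 ^ k)" using f1_ge_2 by simp
  finally show ?thesis .
next
  case False
  then have r: "0 < max_gaps k" by simp
  have "min_gap k \<le> min_gap k * max_gaps k" using r by simp
  then have "min_gap k \<le> f 1 * 2 ^ k" using min_gap_mult_max_gaps_le le_trans by blast
  then have "2 ^ k * min_gap k ^ max_gaps k \<le> 2 ^ k * ((f 1 * 2 ^ k) * min_gap k ^ (max_gaps k - 1))"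
    using r by (simp add: power_eq_if[of _ "max_gaps k"])
  also have "\<dots> = f 1 * ((2 ^ k)\<^sup>2 * min_gap k ^ (max_gaps k - 1))"
    by (simp add: power2_eq_square)
  also have "\<dots> \<le> f 1 * f (2 ^ k)"
    using max_gaps_minimal[OF r] by (intro mult_le_mono2) simp
  finally show ?thesis .
qed

text \<open>
  The maximal length \<open>5 * f 1 * N\<close> leaves room for two outer blocks of length \<open>N\<close> and for
  \<open>r\<close> gaps of size less than \<open>2 * n\<close>, where \<open>n * r \<le> f 1 * N\<close>.
\<close>

definition lang :: "nat list set" where
  "lang = pulse_language min_gap max_gaps (\<lambda>k. 5 * f 1 * 2 ^ k)"

abbreviation stage :: "nat \<Rightarrow> nat list set" where
  "stage k \<equiv> gap_words (min_gap k) (max_gaps k) (5 * f 1 * 2 ^ k)"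

lemma lang_eq: "lang = sparse_words \<union> (\<Union>k. stage k)"
  by (simp add: lang_def pulse_language_def)

definition words_upto :: "nat \<Rightarrow> nat list set" where
  "words_upto m = {w \<in> lang. length w \<le> m}"

lemma words_upto_subset_binary: "words_upto m \<subseteq> {w. set w \<subseteq> {0, 1} \<and> length w \<le> m}"
proof -
  have "set (pulse a xs b) \<subseteq> {0, 1}" for a xs b
    by (induction a xs b rule: pulse.induct) auto
  then show ?thesis
    unfolding words_upto_def lang_eq sparse_words_def gap_words_def by fastforce
qed

lemma finite_words_upto: "finite (words_upto m)"
  by (rule finite_subset[OF words_upto_subset_binary finite_lists_length_le]) simp

lemma f_le_card_words:
  assumes "1 \<le> n"
  shows "f n \<le> card (words_upto (10 * f 1 * n))"
proof -
  obtain k where k: "n \<le> 2 ^ k" "2 ^ k \<le> 2 * n"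
  proof -
    obtain j where "2 ^ j \<le> n" "n < 2 ^ (j + 1)"
      using ex_power_ivl1[of 2 n] assms by auto
    then show ?thesis using that[of "j + 1"] by simp
  qed
  have "f n \<le> f (2 ^ k)" using f_mono assms k(1) by blast
  also have "\<dots> \<le> (2 ^ k)\<^sup>2 * min_gap k ^ max_gaps k" by (rule max_gaps_spec)
  also have "\<dots> \<le> card (stage k)"
  proof (rule card_gap_words_ge)
    have "(2::nat) * 2 ^ k \<le> f 1 * 2 ^ k" using f1_ge_2 by (intro mult_le_mono1)
    moreover have "2 * min_gap k * max_gaps k \<le> 2 * (f 1 * 2 ^ k)" using min_gap_mult_max_gaps_le[of k] by simp
    ultimately show "2 * 2 ^ k + 2 * min_gap k * max_gaps k \<le> 5 * f 1 * 2 ^ k" by linarith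
    show "1 \<le> min_gap k \<or> max_gaps k = 0" using min_gap_ge_2[of k] by linarith
  qed
  also have "\<dots> \<le> card (words_upto (10 * f 1 * n))"
  proof (rule card_mono[OF finite_words_upto])
    have "length w \<le> 10 * f 1 * n" if "w \<in> stage k" for w
    proof -
      have "length w \<le> 5 * f 1 * 2 ^ k" using that unfolding gap_words_def by blast
      also have "\<dots> \<le> 5 * f 1 * (2 * n)" using k(2) by (rule mult_le_mono2)
      finally show ?thesis by simp
    qed
    then show "stage k \<subseteq> words_upto (10 * f 1 * n)"
      unfolding words_upto_def lang_eq by blast
  qed
  finally show ?thesis .
qed

lemma card_stage_le: "card (stage k) \<le> 50 * f 1 ^ 3 * (2 ^ k * f (2 ^ k))"
proof -
  have "card (stage k) \<le> card (gap_box (5 * f 1 * 2 ^ k) (min_gap k) (max_gaps k))"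
    by (rule card_mono[OF finite_gap_box gap_words_subset_gap_box])
  also have "\<dots> \<le> 2 * (5 * f 1 * 2 ^ k)\<^sup>2 * min_gap k ^ max_gaps k"
    using min_gap_ge_2[of k] by (intro card_gap_box_le) linarith
  also have "\<dots> = 50 * f 1 ^ 2 * 2 ^ k * (2 ^ k * min_gap k ^ max_gaps k)"
    by (simp add: power2_eq_square)
  also have "\<dots> \<le> 50 * f 1 ^ 2 * 2 ^ k * (f 1 * f (2 ^ k))"
    using min_gap_power_max_gaps_le by (rule mult_le_mono2)
  finally show ?thesis by (simp add: power2_eq_square power3_eq_cube mult_ac)
qed

text \<open>
  The key estimate for stages far beyond the length \<open>m\<close>. Put \<open>N = 2\<^sup>k\<close>, \<open>n = min_gap k\<close>,
  \<open>r = max_gaps k\<close>, and suppose \<open>f (40 * m) < n ^ t\<close>. Submultiplicativity bounds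
  \<open>f N\<close> by \<open>n ^ (q * t)\<close> with \<open>q \<le> 2 * N / (40 * m)\<close>, while minimality of \<open>r\<close> bounds
  \<open>n ^ r\<close> by \<open>(f N)\<^sup>2\<close>. Hence
  \<open>r < 2 * q * t \<le> 4 * N * t / (40 * m)\<close>. For \<open>t = 5 * (m div n + 1)\<close> one has
  \<open>n * t \<le> 10 * m\<close>, so \<open>n * r < N\<close>. But \<open>n\<close> is \<open>f 1 * N div r\<close> with
  \<open>f 1 \<ge> 2\<close>, so \<open>n * r > N\<close>. The constant \<open>40\<close> is chosen for this contradiction.
\<close>

lemma min_gap_power_le:
  assumes m: "1 \<le> m" and k: "40 * m < 2 ^ k" and r: "0 < max_gaps k" and g: "min_gap k \<le> m"
  shows "min_gap k ^ (5 * (m div min_gap k + 1)) \<le> f (40 * m)"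
proof (rule ccontr)
  define t where "t = 5 * (m div min_gap k + 1)"
  \<comment> \<open>The number of pieces of length \<open>40 * m\<close> that cover \<open>2 ^ k\<close>.\<close>
  define q where "q = 2 ^ k div (40 * m) + 1"
  have g2: "2 \<le> min_gap k" using min_gap_ge_2[OF r] .
  assume "\<not> min_gap k ^ (5 * (m div min_gap k + 1)) \<le> f (40 * m)"
  then have less: "f (40 * m) < min_gap k ^ t" by (simp add: t_def)
  have q: "40 * m * q \<le> 2 * 2 ^ k"
  proof -
    have "40 * m * (2 ^ k div (40 * m)) \<le> 2 ^ k" by (rule times_div_less_eq_dividend)
    moreover have "40 * m * q = 40 * m + 40 * m * (2 ^ k div (40 * m))"
      by (simp add: q_def add_mult_distrib2)
    ultimately show ?thesis using k by linarith
  qed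
  have q': "2 ^ k \<le> 40 * m * q"
  proof -
    have "2 ^ k mod (40 * m) < 40 * m" using m by (intro mod_less_divisor) simp
    moreover have "40 * m * q = 40 * m + 40 * m * (2 ^ k div (40 * m))"
      by (simp add: q_def add_mult_distrib2)
    ultimately show ?thesis using mult_div_mod_eq[of "40 * m" "2 ^ k"] by linarith
  qed
  have "min_gap k ^ max_gaps k \<le> 2 ^ k * min_gap k ^ max_gaps k" by simp
  also have "\<dots> \<le> f 1 * f (2 ^ k)" by (rule min_gap_power_max_gaps_le)
  also have "\<dots> \<le> f (2 ^ k) * f (2 ^ k)"
    using f_mono[of 1 "2 ^ k"] by (intro mult_le_mono1) simp
  also have "\<dots> = f (2 ^ k) ^ 2" by (simp add: power2_eq_square)
  also have "\<dots> \<le> (f (40 * m) ^ q) ^ 2"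
  proof -
    have "f (2 ^ k) \<le> f (40 * m * q)" using q' by (intro f_mono) auto
    also have "\<dots> \<le> f (40 * m) ^ q" using m by (intro f_mult_le) (auto simp: q_def)
    finally show ?thesis by (rule power_mono) simp
  qed
  also have "\<dots> = f (40 * m) ^ (2 * q)" by (simp add: power_mult[symmetric] mult.commute)
  also have "\<dots> < (min_gap k ^ t) ^ (2 * q)"
    using less by (intro power_strict_mono) (auto simp: q_def)
  also have "\<dots> = min_gap k ^ (2 * q * t)" by (simp add: power_mult[symmetric] mult_ac)
  finally have "max_gaps k < 2 * q * t" using g2 by (simp add: power_strict_increasing_iff)
  then have "2 * min_gap k * max_gaps k * (40 * m) \<le> 2 * min_gap k * (2 * q * t) * (40 * m)" by simp
  also have "\<dots> = (4 * min_gap k * t) * (40 * m * q)" by (simp add: mult_ac)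
  also have "\<dots> \<le> (4 * min_gap k * t) * (2 * 2 ^ k)" using q by (rule mult_le_mono2)
  also have "\<dots> \<le> (40 * m) * (2 * 2 ^ k)"
  proof (rule mult_le_mono1)
    have "min_gap k * (m div min_gap k) \<le> m" by (rule times_div_less_eq_dividend)
    moreover have "min_gap k * (m div min_gap k + 1) = min_gap k * (m div min_gap k) + min_gap k" by simp
    ultimately have "min_gap k * (m div min_gap k + 1) \<le> 2 * m" using g by linarith
    moreover have "4 * min_gap k * t = 20 * (min_gap k * (m div min_gap k + 1))"
      by (simp add: t_def algebra_simps)
    ultimately show "4 * min_gap k * t \<le> 40 * m" by linarith
  qed
  finally have "2 * min_gap k * max_gaps k \<le> 2 * 2 ^ k"
    using m by (simp add: mult.commute[of _ "40 * m"] del: mult_cancel_left)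
  also have "\<dots> \<le> f 1 * 2 ^ k" using f1_ge_2 by (rule mult_le_mono1)
  finally show False using min_gap_mult_max_gaps_ge[OF r] by linarith
qed

text \<open>
  Both factors \<open>m\<close> coming from the outer blocks, and the constants, are absorbed into powers of
  \<open>n\<close> by means of \<open>m \<le> n ^ (m div n + 1)\<close>; this is the origin of the exponent
  \<open>5 * (m div n + 1)\<close>.
\<close>

lemma card_gap_box_le_f:
  assumes m: "1 \<le> m" and k: "40 * m < 2 ^ k" and r: "0 < max_gaps k" and g: "min_gap k \<le> m"
  shows "card (gap_box m (min_gap k) (m div min_gap k)) \<le> f (40 * m)"
proof -
  define s where "s = m div min_gap k"
  have g2: "2 \<le> min_gap k" using min_gap_ge_2[OF r] .
  have "m \<le> min_gap k ^ Suc s"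
  proof -
    have "m < min_gap k * Suc s"
      using g2 dividend_less_times_div[of "min_gap k" m] unfolding s_def by simp
    also have "\<dots> \<le> min_gap k * min_gap k ^ s"
    proof -
      have "Suc s \<le> 2 ^ s" using Suc_leI[OF less_exp[of s]] by simp
      also have "\<dots> \<le> min_gap k ^ s" using g2 by (intro power_mono) auto
      finally show ?thesis by (rule mult_le_mono2)
    qed
    finally show ?thesis by simp
  qed
  then have m2: "m\<^sup>2 \<le> (min_gap k ^ Suc s)\<^sup>2" by (rule power_mono) simp
  have "card (gap_box m (min_gap k) s) \<le> 2 * m\<^sup>2 * min_gap k ^ s"
    using g2 by (intro card_gap_box_le) simp
  also have "\<dots> \<le> (min_gap k * (min_gap k ^ Suc s)\<^sup>2) * min_gap k ^ s"
    using m2 g2 by (intro mult_le_mono) auto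
  also have "\<dots> = min_gap k ^ (1 + 2 * Suc s + s)"
    by (simp add: power_add power_mult power2_eq_square mult_ac power3_eq_cube flip: power_mult_distrib)
  also have "\<dots> \<le> min_gap k ^ (5 * (s + 1))" using g2 by (intro power_increasing) auto
  also have "\<dots> \<le> f (40 * m)" unfolding s_def using min_gap_power_le[OF assms] .
  finally show ?thesis by (simp add: s_def)
qed

text \<open>
  The early stages are taken completely. Late stages are grouped by their minimal gap, not by \<open>k\<close>:
  there are infinitely many of them, but only \<open>m\<close> minimal gaps up to \<open>m\<close>, and late
  stages whose minimal gap exceeds \<open>m\<close> only contribute sparse words.
\<close>

lemma words_upto_subset:
  fixes m :: nat
  defines "G \<equiv> min_gap ` {k. 40 * m < 2 ^ k \<and> 0 < max_gaps k \<and> min_gap k \<le> m}"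
  defines "K \<equiv> {k. 2 ^ k \<le> 40 * m}"
  shows "words_upto m \<subseteq> {w \<in> sparse_words. length w \<le> m} \<union> (\<Union>k\<in>K. stage k) \<union>
    (\<Union>g\<in>G. gap_box m g (m div g))"
proof
  fix w assume "w \<in> words_upto m"
  then have len: "length w \<le> m" and "w \<in> lang" by (auto simp: words_upto_def)
  then consider "w \<in> sparse_words" | k where "w \<in> stage k" by (auto simp: lang_eq)
  then show "w \<in> {w \<in> sparse_words. length w \<le> m} \<union> (\<Union>k\<in>K. stage k) \<union>
    (\<Union>g\<in>G. gap_box m g (m div g))"
  proof cases
    case 1
    then show ?thesis using len by simp
  next
    case 2
    show ?thesis
    proof (cases "2 ^ k \<le> 40 * m")
      case True
      then show ?thesis using 2 by (auto simp: K_def)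
    next
      case big: False
      show ?thesis
      proof (cases "m < min_gap k \<or> max_gaps k = 0")
        case True
        then show ?thesis using short_gap_word_sparse[OF 2 len] len by simp
      next
        case False
        then have "0 < min_gap k" using min_gap_ge_2[of k] by simp
        moreover have "min_gap k \<in> G" using False big by (auto simp: G_def)
        ultimately show ?thesis using short_gap_word_in_gap_box[OF 2 len] by blast
      qed
    qed
  qed
qed

lemma sum_powers_of_2_le:
  assumes "1 \<le> c"
  shows "(\<Sum>k\<in>{k. (2::nat) ^ k \<le> c}. 2 ^ k) \<le> 2 * c"
proof -
  obtain j where j: "2 ^ j \<le> c" "c < 2 ^ (j + 1)"
    using ex_power_ivl1[of 2 c] assms by auto
  have "{k. (2::nat) ^ k \<le> c} \<subseteq> {..<j + 1}"
  proof
    fix k assume "k \<in> {k. (2::nat) ^ k \<le> c}"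
    then have "(2::nat) ^ k < 2 ^ (j + 1)" using j by simp
    then have "k < j + 1" by (rule power_less_imp_less_exp[rotated]) simp
    then show "k \<in> {..<j + 1}" by simp
  qed
  then have "(\<Sum>k\<in>{k. (2::nat) ^ k \<le> c}. 2 ^ k) \<le> (\<Sum>k<j + 1. (2::nat) ^ k)"
    by (intro sum_mono2) auto
  also have "\<dots> \<le> 2 ^ (j + 1)" using sum_power2[of "j + 1"] by (simp add: lessThan_atLeast0)
  also have "\<dots> \<le> 2 * c" using j by simp
  finally show ?thesis .
qed

lemma card_words_upto_le:
  assumes m: "1 \<le> m"
  shows "card (words_upto m) \<le> (5 + 4000 * f 1 ^ 3) * m * f (40 * m)"
proof -
  define G where "G = min_gap ` {k. 40 * m < 2 ^ k \<and> 0 < max_gaps k \<and> min_gap k \<le> m}"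
  define K where "K = {k. (2::nat) ^ k \<le> 40 * m}"
  have G: "G \<subseteq> {1..m}"
  proof
    fix g assume "g \<in> G"
    then obtain k where "g = min_gap k" "0 < max_gaps k" "min_gap k \<le> m" by (auto simp: G_def)
    then show "g \<in> {1..m}" using min_gap_ge_2[of k] by simp
  qed
  then have finG: "finite G" and cardG: "card G \<le> m"
    using finite_subset card_mono[of "{1..m}" G] by auto
  have finK: "finite K"
  proof (rule finite_subset)
    show "K \<subseteq> {..40 * m}"
    proof
      fix k assume "k \<in> K"
      then have "k \<le> 40 * m"
        unfolding K_def mem_Collect_eq by (rule less_imp_le[OF less_le_trans[OF less_exp]])
      then show "k \<in> {..40 * m}" by simp
    qed
  qed simp
  have "card (words_upto m)
      \<le> card ({w \<in> sparse_words. length w \<le> m} \<union> (\<Union>k\<in>K. stage k) \<union> (\<Union>g\<in>G. gap_box m g (m div g)))"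
    using words_upto_subset[of m, folded G_def K_def]
    by (intro card_mono finite_UnI finite_UN_I finite_card_sparse_words(1)[OF m] finK finG
        finite_gap_words finite_gap_box)
  also have "\<dots> \<le> card {w \<in> sparse_words. length w \<le> m} + card (\<Union>k\<in>K. stage k)
      + card (\<Union>g\<in>G. gap_box m g (m div g))"
    by (meson add_le_mono1 card_Un_le le_trans)
  also have "\<dots> \<le> 4 * (m * f (40 * m)) + 4000 * f 1 ^ 3 * (m * f (40 * m)) + m * f (40 * m)"
  proof (intro add_mono)
    have "m \<le> f (40 * m)" using f_ge_self[OF m] f_mono[of m "40 * m"] m by simp
    then show "card {w \<in> sparse_words. length w \<le> m} \<le> 4 * (m * f (40 * m))"
      using finite_card_sparse_words(2)[OF m]
      by (simp add: power2_eq_square order.trans)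
    have "card (\<Union>k\<in>K. stage k) \<le> (\<Sum>k\<in>K. card (stage k))" by (rule card_UN_le[OF finK])
    also have "\<dots> \<le> (\<Sum>k\<in>K. 50 * f 1 ^ 3 * (2 ^ k * f (40 * m)))"
    proof (rule sum_mono)
      fix k assume "k \<in> K"
      then have "f (2 ^ k) \<le> f (40 * m)" by (intro f_mono) (auto simp: K_def)
      then show "card (stage k) \<le> 50 * f 1 ^ 3 * (2 ^ k * f (40 * m))"
        by (intro le_trans[OF card_stage_le] mult_le_mono2)
    qed
    also have "\<dots> = 50 * f 1 ^ 3 * f (40 * m) * (\<Sum>k\<in>K. 2 ^ k)"
      unfolding sum_distrib_left by (intro sum.cong) (simp_all only: mult_ac)
    also have "\<dots> \<le> 50 * f 1 ^ 3 * f (40 * m) * (2 * (40 * m))"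
      using sum_powers_of_2_le[of "40 * m"] m unfolding K_def by (intro mult_le_mono2) simp
    finally show "card (\<Union>k\<in>K. stage k) \<le> 4000 * f 1 ^ 3 * (m * f (40 * m))"
      by (simp add: mult_ac)
    have "card (\<Union>g\<in>G. gap_box m g (m div g)) \<le> (\<Sum>g\<in>G. card (gap_box m g (m div g)))"
      by (rule card_UN_le[OF finG])
    also have "\<dots> \<le> (\<Sum>g\<in>G. f (40 * m))"
      using card_gap_box_le_f[OF m] by (intro sum_mono) (auto simp: G_def)
    also have "\<dots> \<le> m * f (40 * m)" using cardG by simp
    finally show "card (\<Union>g\<in>G. gap_box m g (m div g)) \<le> m * f (40 * m)" .
  qed
  also have "\<dots> = (5 + 4000 * f 1 ^ 3) * m * f (40 * m)" by (simp add: algebra_simps)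
  finally show ?thesis .
qed

end

section \<open>Filtrations of associative algebras\<close>

context vectorspace
begin

lemma subspace_trans:
  assumes "subspace K U V" "subspace K W V" "U \<subseteq> W"
  shows "subspace K U (vs W)"
proof -
  have "vectorspace K (vs W)" by (rule subspace_is_vs[OF assms(2)])
  moreover have "submodule K U (vs W)"
    using assms subspace_is_vs[OF assms(2)]
    by (auto simp: subspace_def submodule_def vectorspace_def)
  ultimately show ?thesis by (simp add: subspace_def)
qed

text \<open>
  A maximal linearly independent subset of the subspace is a basis of it; it exists because
  independent sets in the whole space have at most \<open>dim\<close> elements.
\<close>

lemma subspace_fin_dim_le:
  assumes U: "subspace K U V" and fd: "fin_dim"
  shows "vectorspace.fin_dim K (vs U)" "vectorspace.dim K (vs U) \<le> dim"
proof -
  interpret U: vectorspace K "vs U" by (rule subspace_is_vs[OF U])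
  have sm: "submodule K U V" using U by simp
  have UV: "U \<subseteq> carrier V" using sm by (simp add: submodule_def)
  have li: "finite A \<and> card A \<le> dim \<and> lin_indpt A" if "A \<subseteq> U" "U.lin_indpt A" for A
  proof -
    have "lin_indpt A" using that span_li_not_depend(2)[OF that(1) sm] by simp
    then show ?thesis using li_le_dim[OF fd, of A] that UV by auto
  qed
  have "\<exists>A. finite A \<and> maximal A (\<lambda>S. S \<subseteq> carrier (vs U) \<and> U.lin_indpt S)"
  proof (rule maximal_exists[where N = dim and B = "{}"])
    show "\<And>A. A \<subseteq> carrier (vs U) \<and> U.lin_indpt A \<Longrightarrow> finite A \<and> card A \<le> dim"
      using li by simp
  qed (auto simp: U.lin_dep_def)
  then obtain A where A: "finite A" "maximal A (\<lambda>S. S \<subseteq> carrier (vs U) \<and> U.lin_indpt S)"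
    by blast
  then have AU: "A \<subseteq> U" "U.lin_indpt A" by (auto simp: maximal_def)
  have "U.basis A"
    by (rule U.max_li_is_basis) (use A AU in \<open>auto simp: maximal_def\<close>)
  then show "U.fin_dim" "U.dim \<le> dim"
    using A(1) li[OF AU] U.dim_basis[OF A(1)] by (auto simp: U.fin_dim_def U.basis_def)
qed

lemma subspace_dim_mono:
  assumes "subspace K U V" "subspace K W V" "U \<subseteq> W" "vectorspace.fin_dim K (vs W)"
  shows "vectorspace.fin_dim K (vs U)" "vectorspace.dim K (vs U) \<le> vectorspace.dim K (vs W)"
proof -
  interpret W: vectorspace K "vs W" by (rule subspace_is_vs[OF assms(2)])
  have "subspace K U (vs W)" by (rule subspace_trans[OF assms(1-3)])
  from W.subspace_fin_dim_le[OF this assms(4)]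
  show "vectorspace.fin_dim K (vs U)" "vectorspace.dim K (vs U) \<le> vectorspace.dim K (vs W)"
    by simp_all
qed

lemma span_subset_subspace: "S \<subseteq> W \<Longrightarrow> subspace K W V \<Longrightarrow> span S \<subseteq> W"
  by (intro span_is_subset) auto

end

context assoc_algebra
begin

lemma subspace_subset: "subspace F W A \<Longrightarrow> W \<subseteq> carrier A"
  by (simp add: subspace_def submodule_def)

text \<open>
  Products of spans are handled without expanding linear combinations: for fixed \<open>x\<close>, the
  elements \<open>y\<close> with \<open>x \<otimes> y \<in> W\<close> form a subspace, so it suffices to check generators.
\<close>

lemma subspace_right_multipliers:
  assumes "x \<in> carrier A" "subspace F W A"
  shows "subspace F {y \<in> carrier A. x \<otimes>\<^bsub>A\<^esub> y \<in> W} A"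
  using assms vectorspace_axioms module_axioms
  by (auto simp: subspace_def submodule_def A.r_distr smult_mult_right)

lemma subspace_left_multipliers:
  assumes "y \<in> carrier A" "subspace F W A"
  shows "subspace F {x \<in> carrier A. x \<otimes>\<^bsub>A\<^esub> y \<in> W} A"
  using assms vectorspace_axioms module_axioms
  by (auto simp: subspace_def submodule_def A.l_distr smult_mult_left)

lemma subspace_power_subspace:
  assumes V: "V \<subseteq> carrier A"
  shows "subspace F (subspace_power V n) A"
proof (induction n)
  case (Suc n)
  have "{x \<otimes>\<^bsub>A\<^esub> y |x y. x \<in> subspace_power V n \<and> y \<in> V} \<subseteq> carrier A"
    using subspace_subset[OF Suc] V by auto
  then show ?case by (simp add: subspace_prod_def span_is_subspace)
qed (simp add: span_is_subspace)

lemma filtration_subspace: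
  assumes V: "V \<subseteq> carrier A"
  shows "subspace F (filtration V n) A"
proof (induction n)
  case (Suc n)
  then show ?case using sum_is_subspace subspace_power_subspace[OF V, of "Suc n"] by simp
qed (use subspace_power_subspace[OF V, of 0] in simp)

lemma filtration_minimal:
  assumes V: "V \<subseteq> carrier A" and W: "subspace F W A"
  shows "filtration V n \<subseteq> W \<longleftrightarrow> (\<forall>i\<le>n. subspace_power V i \<subseteq> W)"
proof (induction n)
  case (Suc n)
  then show ?case
    using vsum_is_minimal[OF filtration_subspace[OF V] subspace_power_subspace[OF V] W, of n "Suc n"]
    by (auto simp: le_Suc_eq simp del: subspace_power.simps)
qed simp

lemma subspace_power_subset_filtration:
  "V \<subseteq> carrier A \<Longrightarrow> i \<le> n \<Longrightarrow> subspace_power V i \<subseteq> filtration V n"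
  using filtration_minimal[OF _ filtration_subspace] by blast

lemma filtration_mono: "V \<subseteq> carrier A \<Longrightarrow> m \<le> n \<Longrightarrow> filtration V m \<subseteq> filtration V n"
  using filtration_minimal[OF _ filtration_subspace] subspace_power_subset_filtration by simp

lemma one_in_subspace_power_0: "\<one>\<^bsub>A\<^esub> \<in> subspace_power V 0"
  using in_own_span[of "{\<one>\<^bsub>A\<^esub>}"] by simp

lemma subspace_power_mult:
  assumes V: "V \<subseteq> carrier A" and x: "x \<in> subspace_power V m"
    and y: "y \<in> subspace_power V n"
  shows "x \<otimes>\<^bsub>A\<^esub> y \<in> subspace_power V (m + n)"
  using y
proof (induction n arbitrary: y)
  case 0
  have xc: "x \<in> carrier A" using x subspace_subset[OF subspace_power_subspace[OF V]] by blast
  have "span {\<one>\<^bsub>A\<^esub>} \<subseteq> {y \<in> carrier A. x \<otimes>\<^bsub>A\<^esub> y \<in> subspace_power V m}"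
    using xc x
    by (intro span_subset_subspace subspace_right_multipliers subspace_power_subspace[OF V]) auto
  then show ?case using 0 by auto
next
  case (Suc n)
  have xc: "x \<in> carrier A" using x subspace_subset[OF subspace_power_subspace[OF V]] by blast
  let ?P = "subspace_power V (m + Suc n)"
  let ?G = "{u \<otimes>\<^bsub>A\<^esub> v |u v. u \<in> subspace_power V n \<and> v \<in> V}"
  let ?H = "{u \<otimes>\<^bsub>A\<^esub> v |u v. u \<in> subspace_power V (m + n) \<and> v \<in> V}"
  have Hc: "?H \<subseteq> carrier A"
    using subspace_subset[OF subspace_power_subspace[OF V, of "m + n"]] V by auto
  have "?G \<subseteq> {y \<in> carrier A. x \<otimes>\<^bsub>A\<^esub> y \<in> ?P}"
  proof clarify
    fix u v assume u: "u \<in> subspace_power V n" and v: "v \<in> V"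
    have c: "u \<in> carrier A" "v \<in> carrier A"
      using u v V subspace_subset[OF subspace_power_subspace[OF V]] by blast+
    have "x \<otimes>\<^bsub>A\<^esub> (u \<otimes>\<^bsub>A\<^esub> v) = (x \<otimes>\<^bsub>A\<^esub> u) \<otimes>\<^bsub>A\<^esub> v"
      using xc c by (simp add: A.m_assoc)
    also have "\<dots> \<in> ?H" using Suc.IH[OF u] v by blast
    also have "?H \<subseteq> ?P" using in_own_span[OF Hc] by (simp add: subspace_prod_def)
    finally show "u \<otimes>\<^bsub>A\<^esub> v \<in> carrier A \<and> x \<otimes>\<^bsub>A\<^esub> (u \<otimes>\<^bsub>A\<^esub> v) \<in> ?P" using c by simp
  qed
  then have "span ?G \<subseteq> {y \<in> carrier A. x \<otimes>\<^bsub>A\<^esub> y \<in> ?P}"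
    by (rule span_subset_subspace[OF _ subspace_right_multipliers[OF xc subspace_power_subspace[OF V]]])
  then show ?case using Suc.prems by (auto simp: subspace_prod_def)
qed

lemma filtration_mult:
  assumes V: "V \<subseteq> carrier A" and x: "x \<in> filtration V m" and y: "y \<in> filtration V n"
  shows "x \<otimes>\<^bsub>A\<^esub> y \<in> filtration V (m + n)"
proof -
  let ?W = "filtration V (m + n)"
  have W: "subspace F ?W A" by (rule filtration_subspace[OF V])
  have powc: "subspace_power V i \<subseteq> carrier A" for i
    using subspace_subset[OF subspace_power_subspace[OF V]] .
  have *: "u \<otimes>\<^bsub>A\<^esub> y \<in> ?W" if u: "u \<in> subspace_power V i" "i \<le> m" for u i
  proof -
    have uc: "u \<in> carrier A" using u powc by blast
    have "subspace_power V j \<subseteq> {y \<in> carrier A. u \<otimes>\<^bsub>A\<^esub> y \<in> ?W}" if "j \<le> n" for j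
      using subspace_power_mult[OF V u(1)] subspace_power_subset_filtration[OF V, of "i + j" "m + n"]
        that u(2) powc by fastforce
    then have "filtration V n \<subseteq> {y \<in> carrier A. u \<otimes>\<^bsub>A\<^esub> y \<in> ?W}"
      using filtration_minimal[OF V subspace_right_multipliers[OF uc W]] by blast
    then show ?thesis using y by blast
  qed
  have yc: "y \<in> carrier A" using y subspace_subset[OF filtration_subspace[OF V]] by blast
  have "subspace_power V i \<subseteq> {x \<in> carrier A. x \<otimes>\<^bsub>A\<^esub> y \<in> ?W}" if "i \<le> m" for i
    using * that powc by blast
  then have "filtration V m \<subseteq> {x \<in> carrier A. x \<otimes>\<^bsub>A\<^esub> y \<in> ?W}"
    using filtration_minimal[OF V subspace_left_multipliers[OF yc W]] by blast
  then show ?thesis using x by blast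
qed

lemma subset_filtration_1:
  assumes V: "V \<subseteq> carrier A"
  shows "V \<subseteq> filtration V 1"
proof -
  let ?G = "{u \<otimes>\<^bsub>A\<^esub> v |u v. u \<in> subspace_power V 0 \<and> v \<in> V}"
  have "?G \<subseteq> carrier A"
    using subspace_subset[OF subspace_power_subspace[OF V, of 0]] V by auto
  then have "?G \<subseteq> subspace_power V 1"
    using in_own_span[of ?G] by (simp add: subspace_prod_def)
  moreover have "V \<subseteq> ?G"
  proof
    fix v assume "v \<in> V"
    moreover have "v = \<one>\<^bsub>A\<^esub> \<otimes>\<^bsub>A\<^esub> v" using \<open>v \<in> V\<close> V by auto
    ultimately show "v \<in> ?G" using one_in_subspace_power_0 by blast
  qed
  ultimately show ?thesis using subspace_power_subset_filtration[OF V, of 1 1] by blast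
qed

text \<open>
  The union of the filtration is a unital subalgebra that contains the generators.
\<close>

lemma filtration_exhausts:
  assumes "generates_algebra V"
  shows "(\<Union>n. filtration V n) = carrier A"
proof -
  have V: "V \<subseteq> carrier A" using assms by (simp add: generates_algebra_def)
  let ?B = "\<Union>n. filtration V n"
  note sub = filtration_subspace[OF V]
  have common: "\<exists>n. x \<in> filtration V n \<and> y \<in> filtration V n" if "x \<in> ?B" "y \<in> ?B" for x y
  proof -
    from that obtain m n where "x \<in> filtration V m" "y \<in> filtration V n" by blast
    then have "x \<in> filtration V (max m n)" "y \<in> filtration V (max m n)"
      using filtration_mono[OF V] by (meson max.cobounded1 max.cobounded2 subsetD)+
    then show ?thesis by blast
  qed
  have "submodule F ?B A"
    unfolding submodule_def
  proof (intro conjI allI impI)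
    show "module F A" by (rule module_axioms)
    show "?B \<subseteq> carrier A" using subspace_subset[OF sub] by blast
    have "\<zero>\<^bsub>A\<^esub> \<in> filtration V 0"
      using sub[of 0] unfolding subspace_def submodule_def by blast
    then show "\<zero>\<^bsub>A\<^esub> \<in> ?B" by blast
  next
    fix v w assume "v \<in> ?B" "w \<in> ?B"
    then obtain n where "v \<in> filtration V n" "w \<in> filtration V n" using common by blast
    then have "v \<oplus>\<^bsub>A\<^esub> w \<in> filtration V n" using sub[of n] by (simp add: subspace_def submodule_def)
    then show "v \<oplus>\<^bsub>A\<^esub> w \<in> ?B" by blast
  next
    fix c v assume "c \<in> carrier F" "v \<in> ?B"
    then obtain n where "v \<in> filtration V n" by blast
    then have "c \<odot>\<^bsub>A\<^esub> v \<in> filtration V n"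
      using sub[of n] \<open>c \<in> carrier F\<close> by (simp add: subspace_def submodule_def)
    then show "c \<odot>\<^bsub>A\<^esub> v \<in> ?B" by blast
  qed
  then have "subspace F ?B A" using vectorspace_axioms by (simp add: subspace_def)
  moreover have "\<one>\<^bsub>A\<^esub> \<in> ?B"
    using one_in_subspace_power_0 subspace_power_subset_filtration[OF V, of 0 0] by blast
  moreover have "\<forall>x\<in>?B. \<forall>y\<in>?B. x \<otimes>\<^bsub>A\<^esub> y \<in> ?B" using filtration_mult[OF V] by blast
  ultimately have "unital_subalgebra ?B" by (simp add: unital_subalgebra_def)
  moreover have "V \<subseteq> ?B" using subset_filtration_1[OF V] by blast
  ultimately show ?thesis using assms by (simp add: generates_algebra_def)
qed

lemma finite_subset_filtration:
  assumes "generates_algebra V" "finite S" "S \<subseteq> carrier A"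
  shows "\<exists>c\<ge>1. S \<subseteq> filtration V c"
proof -
  have V: "V \<subseteq> carrier A" using assms(1) by (simp add: generates_algebra_def)
  from assms(2,3) show ?thesis
  proof (induction S)
    case empty
    then show ?case by auto
  next
    case (insert x S)
    then obtain c where c: "c \<ge> 1" "S \<subseteq> filtration V c" by auto
    obtain d where "x \<in> filtration V d"
      using insert.prems filtration_exhausts[OF assms(1)] by blast
    then have "insert x S \<subseteq> filtration V (max c d)"
      using c(2) filtration_mono[OF V, of c "max c d"] filtration_mono[OF V, of d "max c d"] by auto
    then show ?case using c(1) by (intro exI[of _ "max c d"]) auto
  qed
qed

end

section \<open>Monomial algebras\<close>

text \<open>
  The value at \<open>w\<close> of the product of two functions on words, that is, the sum of
  \<open>x u \<otimes> y v\<close> over all factorizations \<open>w = u @ v\<close>. Recursion on \<open>w\<close>, peeling off the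
  empty prefix, makes associativity and bilinearity plain inductions
  that need no interchange of finite sums.
\<close>

fun conv :: "('a, 'm) ring_scheme \<Rightarrow> ('b list \<Rightarrow> 'a) \<Rightarrow> ('b list \<Rightarrow> 'a) \<Rightarrow> 'b list \<Rightarrow> 'a" where
  "conv R x y [] = x [] \<otimes>\<^bsub>R\<^esub> y []"
| "conv R x y (a # w) = x [] \<otimes>\<^bsub>R\<^esub> y (a # w) \<oplus>\<^bsub>R\<^esub> conv R (\<lambda>u. x (a # u)) y w"

definition monomial_algebra ::
    "('a, 'm) ring_scheme \<Rightarrow> 'b list set \<Rightarrow> ('a, 'b list \<Rightarrow> 'a) module" where
  "monomial_algebra R L = \<lparr>
     carrier = {x. (\<forall>w. x w \<in> carrier R) \<and> finite {w. x w \<noteq> \<zero>\<^bsub>R\<^esub>} \<and> (\<forall>w. w \<notin> L \<longrightarrow> x w = \<zero>\<^bsub>R\<^esub>)},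
     monoid.mult = (\<lambda>x y w. if w \<in> L then conv R x y w else \<zero>\<^bsub>R\<^esub>),
     one = (\<lambda>w. if w = [] then \<one>\<^bsub>R\<^esub> else \<zero>\<^bsub>R\<^esub>),
     zero = (\<lambda>w. \<zero>\<^bsub>R\<^esub>),
     add = (\<lambda>x y w. x w \<oplus>\<^bsub>R\<^esub> y w),
     smult = (\<lambda>c x w. c \<otimes>\<^bsub>R\<^esub> x w)\<rparr>"

definition monomial :: "('a, 'm) ring_scheme \<Rightarrow> 'b list \<Rightarrow> 'b list \<Rightarrow> 'a" where
  "monomial R u w = (if w = u then \<one>\<^bsub>R\<^esub> else \<zero>\<^bsub>R\<^esub>)"

context cring
begin

lemma conv_closed:
  assumes "\<And>w. x w \<in> carrier R" "\<And>w. y w \<in> carrier R"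
  shows "conv R x y w \<in> carrier R"
  using assms by (induction w arbitrary: x) auto

lemma conv_add_left:
  assumes "\<And>w. x w \<in> carrier R" "\<And>w. x' w \<in> carrier R" "\<And>w. y w \<in> carrier R"
  shows "conv R (\<lambda>u. x u \<oplus> x' u) y w = conv R x y w \<oplus> conv R x' y w"
  using assms by (induction w arbitrary: x x') (simp_all add: conv_closed l_distr a_ac)

lemma conv_add_right:
  assumes "\<And>w. x w \<in> carrier R" "\<And>w. y w \<in> carrier R" "\<And>w. y' w \<in> carrier R"
  shows "conv R x (\<lambda>u. y u \<oplus> y' u) w = conv R x y w \<oplus> conv R x y' w"
  using assms by (induction w arbitrary: x) (simp_all add: conv_closed r_distr a_ac)

lemma conv_smult_left:
  assumes "c \<in> carrier R" "\<And>w. x w \<in> carrier R" "\<And>w. y w \<in> carrier R"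
  shows "conv R (\<lambda>u. c \<otimes> x u) y w = c \<otimes> conv R x y w"
  using assms by (induction w arbitrary: x) (simp_all add: conv_closed r_distr m_assoc)

lemma conv_smult_right:
  assumes "c \<in> carrier R" "\<And>w. x w \<in> carrier R" "\<And>w. y w \<in> carrier R"
  shows "conv R x (\<lambda>u. c \<otimes> y u) w = c \<otimes> conv R x y w"
  using assms by (induction w arbitrary: x) (simp_all add: conv_closed r_distr m_lcomm)

text \<open>
  The function \<open>\<lambda>u. conv R x y (a # u)\<close> is the sum of a multiple of \<open>\<lambda>u. y (a # u)\<close> and of
  a convolution with \<open>\<lambda>u. x (a # u)\<close>. Linearity in the left argument therefore reduces the
  claim for \<open>a # w\<close> to the claim for \<open>w\<close>.
\<close>

lemma conv_assoc:
  assumes "\<And>w. x w \<in> carrier R" "\<And>w. y w \<in> carrier R" "\<And>w. z w \<in> carrier R"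
  shows "conv R (conv R x y) z w = conv R x (conv R y z) w"
  using assms
proof (induction w arbitrary: x y)
  case Nil
  then show ?case by (simp add: m_assoc)
next
  case (Cons a w)
  have "conv R (conv R x y) z (a # w) = (x [] \<otimes> y []) \<otimes> z (a # w) \<oplus>
      conv R (\<lambda>u. x [] \<otimes> y (a # u) \<oplus> conv R (\<lambda>u. x (a # u)) y u) z w"
    by simp
  also have "\<dots> = (x [] \<otimes> y []) \<otimes> z (a # w) \<oplus>
      (x [] \<otimes> conv R (\<lambda>u. y (a # u)) z w \<oplus> conv R (\<lambda>u. x (a # u)) (conv R y z) w)"
    using Cons.prems Cons.IH[of "\<lambda>u. x (a # u)" y]
    by (simp add: conv_add_left conv_smult_left conv_closed)
  also have "\<dots> = conv R x (conv R y z) (a # w)"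
    using Cons.prems by (simp add: conv_closed r_distr m_assoc a_assoc)
  finally show ?case .
qed

lemma conv_cong:
  assumes "\<And>u v. u @ v = w \<Longrightarrow> x u = x' u \<and> y v = y' v"
  shows "conv R x y w = conv R x' y' w"
  using assms
proof (induction w arbitrary: x x')
  case (Cons a w)
  have "x [] = x' []" "y (a # w) = y' (a # w)" using Cons.prems[of "[]" "a # w"] by simp_all
  moreover have "conv R (\<lambda>u. x (a # u)) y w = conv R (\<lambda>u. x' (a # u)) y' w"
    using Cons.prems by (intro Cons.IH) auto
  ultimately show ?case by simp
qed simp

lemma conv_zero:
  assumes "\<And>u v. u @ v = w \<Longrightarrow> x u = \<zero> \<or> y v = \<zero>"
    and "\<And>w. x w \<in> carrier R" "\<And>w. y w \<in> carrier R"
  shows "conv R x y w = \<zero>"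
  using assms
proof (induction w arbitrary: x)
  case Nil
  then show ?case using Nil.prems(1)[of "[]" "[]"] by auto
next
  case (Cons a w)
  have "x [] \<otimes> y (a # w) = \<zero>" using Cons.prems(1)[of "[]" "a # w"] Cons.prems(2,3) by auto
  moreover have "conv R (\<lambda>u. x (a # u)) y w = \<zero>"
    using Cons.prems by (intro Cons.IH) auto
  ultimately show ?case by simp
qed

lemma conv_monomial_left:
  assumes "\<And>w. y w \<in> carrier R"
  shows "conv R (monomial R u) y w = (if \<exists>v. w = u @ v then y (drop (length u) w) else \<zero>)"
proof (induction w arbitrary: u)
  case Nil
  then show ?case using assms by (auto simp: monomial_def)
next
  case (Cons a w)
  show ?case
  proof (cases u)
    case Nil
    have "conv R (\<lambda>v. monomial R u (a # v)) y w = \<zero>"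
      using assms Nil by (intro conv_zero) (auto simp: monomial_def)
    then show ?thesis using assms Nil by (simp add: monomial_def)
  next
    case (Cons b u')
    show ?thesis
    proof (cases "a = b")
      case True
      then have "(\<lambda>v. monomial R u (a # v)) = monomial R u'"
        using Cons by (auto simp: monomial_def fun_eq_iff)
      then show ?thesis using assms Cons True Cons.IH[of u']
        by (simp add: monomial_def conv_closed)
    next
      case False
      then have "conv R (\<lambda>v. monomial R u (a # v)) y w = \<zero>"
        using assms Cons by (intro conv_zero) (auto simp: monomial_def)
      then show ?thesis using assms Cons False by (simp add: monomial_def)
    qed
  qed
qed

lemma conv_one_right:
  assumes "\<And>w. x w \<in> carrier R"
  shows "conv R x (monomial R []) w = x w"
  using assms
proof (induction w arbitrary: x)
  case (Cons a w)
  then show ?case using Cons.IH[of "\<lambda>u. x (a # u)"] by (simp add: monomial_def)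
qed (simp add: monomial_def)

end

text \<open>
  Factor-closedness of \<open>L\<close> says that the words outside \<open>L\<close> span an ideal of the free algebra, so
  that truncating products to \<open>L\<close> remains associative.
\<close>

locale monomial_algebra_over = field F for F :: "('a, 'm) ring_scheme" (structure) +
  fixes L :: "'b list set" and A
  assumes closed: "factor_closed L" and Nil_in: "[] \<in> L"
  defines "A \<equiv> monomial_algebra F L"
begin

lemma carrier_A: "x \<in> carrier A \<longleftrightarrow>
    (\<forall>w. x w \<in> carrier F) \<and> finite {w. x w \<noteq> \<zero>} \<and> (\<forall>w. w \<notin> L \<longrightarrow> x w = \<zero>)"
  by (simp add: A_def monomial_algebra_def)

lemma value_closed: "x \<in> carrier A \<Longrightarrow> x w \<in> carrier F"
  by (simp add: carrier_A)

lemma mult_A: "x \<otimes>\<^bsub>A\<^esub> y = (\<lambda>w. if w \<in> L then conv F x y w else \<zero>)"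
  by (simp add: A_def monomial_algebra_def)

lemma one_A: "\<one>\<^bsub>A\<^esub> = monomial F []"
  by (auto simp: A_def monomial_algebra_def monomial_def)

lemma zero_A: "\<zero>\<^bsub>A\<^esub> = (\<lambda>w. \<zero>)"
  by (simp add: A_def monomial_algebra_def)

lemma add_A: "x \<oplus>\<^bsub>A\<^esub> y = (\<lambda>w. x w \<oplus> y w)"
  by (simp add: A_def monomial_algebra_def)

lemma smult_A: "c \<odot>\<^bsub>A\<^esub> x = (\<lambda>w. c \<otimes> x w)"
  by (simp add: A_def monomial_algebra_def)

lemma monomial_carrier: "u \<in> L \<Longrightarrow> monomial F u \<in> carrier A"
  by (auto simp: carrier_A monomial_def)

lemma mult_support:
  assumes "x \<in> carrier A" "y \<in> carrier A" "(x \<otimes>\<^bsub>A\<^esub> y) w \<noteq> \<zero>"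
  shows "\<exists>u v. w = u @ v \<and> x u \<noteq> \<zero> \<and> y v \<noteq> \<zero>"
  using assms conv_zero[of w x y] by (auto simp: mult_A value_closed split: if_splits)

lemma mult_closed:
  assumes "x \<in> carrier A" "y \<in> carrier A"
  shows "x \<otimes>\<^bsub>A\<^esub> y \<in> carrier A"
proof -
  have "{w. (x \<otimes>\<^bsub>A\<^esub> y) w \<noteq> \<zero>} \<subseteq> (\<lambda>(u, v). u @ v) ` ({u. x u \<noteq> \<zero>} \<times> {v. y v \<noteq> \<zero>})"
    using mult_support[OF assms] by fastforce
  moreover have "finite \<dots>" using assms by (simp add: carrier_A)
  ultimately have "finite {w. (x \<otimes>\<^bsub>A\<^esub> y) w \<noteq> \<zero>}" by (rule finite_subset)
  then show ?thesis using assms by (simp add: carrier_A mult_A conv_closed)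
qed

lemma add_closed_A:
  assumes "x \<in> carrier A" "y \<in> carrier A"
  shows "x \<oplus>\<^bsub>A\<^esub> y \<in> carrier A"
proof -
  have "{w. x w \<oplus> y w \<noteq> \<zero>} \<subseteq> {w. x w \<noteq> \<zero>} \<union> {w. y w \<noteq> \<zero>}" by auto
  moreover have "finite \<dots>" using assms by (simp add: carrier_A)
  ultimately have "finite {w. x w \<oplus> y w \<noteq> \<zero>}" by (rule finite_subset)
  then show ?thesis using assms by (simp add: carrier_A add_A)
qed

lemma smult_closed_A:
  assumes "c \<in> carrier F" "x \<in> carrier A"
  shows "c \<odot>\<^bsub>A\<^esub> x \<in> carrier A"
proof -
  have "{w. c \<otimes> x w \<noteq> \<zero>} \<subseteq> {w. x w \<noteq> \<zero>}" using assms by auto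
  then have "finite {w. c \<otimes> x w \<noteq> \<zero>}"
    using assms by (auto simp: carrier_A intro: finite_subset)
  then show ?thesis using assms by (simp add: carrier_A smult_A)
qed

lemma in_L_factors: "u @ v \<in> L \<Longrightarrow> u \<in> L \<and> v \<in> L"
  using closed unfolding factor_closed_def by blast

lemma mult_assoc_A:
  assumes "x \<in> carrier A" "y \<in> carrier A" "z \<in> carrier A"
  shows "(x \<otimes>\<^bsub>A\<^esub> y) \<otimes>\<^bsub>A\<^esub> z = x \<otimes>\<^bsub>A\<^esub> (y \<otimes>\<^bsub>A\<^esub> z)"
proof
  fix w
  have "conv F (x \<otimes>\<^bsub>A\<^esub> y) z w = conv F (conv F x y) z w"
    and "conv F x (y \<otimes>\<^bsub>A\<^esub> z) w = conv F x (conv F y z) w" if "w \<in> L"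
    using that by (auto intro!: conv_cong simp: mult_A dest: in_L_factors)
  then show "((x \<otimes>\<^bsub>A\<^esub> y) \<otimes>\<^bsub>A\<^esub> z) w = (x \<otimes>\<^bsub>A\<^esub> (y \<otimes>\<^bsub>A\<^esub> z)) w"
    using assms conv_assoc[of x y z w] by (simp add: mult_A value_closed)
qed

lemma is_vectorspace: "vectorspace F A"
proof (rule vs_criteria)
  show "field F" by (rule field_axioms)
  show "\<forall>v\<in>carrier A. \<exists>neg_v\<in>carrier A. v \<oplus>\<^bsub>A\<^esub> neg_v = \<zero>\<^bsub>A\<^esub>"
  proof
    fix v assume v: "v \<in> carrier A"
    have "(\<ominus> \<one>) \<odot>\<^bsub>A\<^esub> v \<in> carrier A" using v by (intro smult_closed_A) auto
    moreover have "v \<oplus>\<^bsub>A\<^esub> (\<ominus> \<one>) \<odot>\<^bsub>A\<^esub> v = \<zero>\<^bsub>A\<^esub>"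
      using v by (simp add: add_A smult_A zero_A value_closed l_minus r_neg)
    ultimately show "\<exists>neg_v\<in>carrier A. v \<oplus>\<^bsub>A\<^esub> neg_v = \<zero>\<^bsub>A\<^esub>" by blast
  qed
  show "\<zero>\<^bsub>A\<^esub> \<in> carrier A" by (simp add: carrier_A zero_A)
qed (auto simp: add_closed_A smult_closed_A,
     auto simp: add_A smult_A zero_A value_closed a_ac m_assoc l_distr r_distr)

lemma is_ring: "ring A"
proof (rule ringI)
  interpret vectorspace F A by (rule is_vectorspace)
  show "abelian_group A" by (rule M.abelian_group_axioms)
  show "monoid A"
  proof (rule monoidI)
    show "\<one>\<^bsub>A\<^esub> \<in> carrier A" using Nil_in by (simp add: one_A monomial_carrier)
  next
    fix x assume x: "x \<in> carrier A"
    then have "x w = \<zero>" if "w \<notin> L" for w using that by (simp add: carrier_A)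
    then show "\<one>\<^bsub>A\<^esub> \<otimes>\<^bsub>A\<^esub> x = x" "x \<otimes>\<^bsub>A\<^esub> \<one>\<^bsub>A\<^esub> = x"
      using x by (auto simp: one_A mult_A conv_monomial_left conv_one_right value_closed fun_eq_iff)
  qed (simp_all add: mult_closed mult_assoc_A)
  fix x y z assume "x \<in> carrier A" "y \<in> carrier A" "z \<in> carrier A"
  then show "(x \<oplus>\<^bsub>A\<^esub> y) \<otimes>\<^bsub>A\<^esub> z = x \<otimes>\<^bsub>A\<^esub> z \<oplus>\<^bsub>A\<^esub> y \<otimes>\<^bsub>A\<^esub> z"
    and "z \<otimes>\<^bsub>A\<^esub> (x \<oplus>\<^bsub>A\<^esub> y) = z \<otimes>\<^bsub>A\<^esub> x \<oplus>\<^bsub>A\<^esub> z \<otimes>\<^bsub>A\<^esub> y"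
    by (auto simp: add_A mult_A conv_add_left conv_add_right value_closed)
qed

lemma is_assoc_algebra: "assoc_algebra F A"
proof -
  have "assoc_algebra_axioms F A"
    by unfold_locales
      (auto simp: mult_A smult_A conv_smult_left conv_smult_right value_closed fun_eq_iff)
  then show ?thesis
    by (simp add: assoc_algebra_def is_vectorspace is_ring)
qed

sublocale alg: assoc_algebra F A
  by (rule is_assoc_algebra)

lemma monomial_mult:
  assumes "u @ v \<in> L"
  shows "monomial F u \<otimes>\<^bsub>A\<^esub> monomial F v = monomial F (u @ v)"
proof
  fix w
  have "\<And>w. monomial F v w \<in> carrier F" by (simp add: monomial_def)
  then show "(monomial F u \<otimes>\<^bsub>A\<^esub> monomial F v) w = monomial F (u @ v) w"
    using assms by (auto simp: mult_A conv_monomial_left) (auto simp: monomial_def)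
qed

end

section \<open>Growth of monomial algebras\<close>

context monomial_algebra_over
begin

lemma inj_monomial: "inj (monomial F)"
  by (rule injI) (metis monomial_def one_not_zero)

text \<open>
  Coefficients are read off pointwise; this yields both independence of the monomials and the
  expansion of an arbitrary element.
\<close>

lemma lincomb_monomials:
  assumes "finite S" "S \<subseteq> L" "\<And>v. a v \<in> carrier F"
  shows "alg.lincomb a (monomial F ` S) = (\<lambda>w. if w \<in> S then a (monomial F w) else \<zero>)"
  using assms(1,2)
proof (induction S)
  case empty
  then show ?case by (simp add: zero_A)
next
  case (insert u S)
  have "alg.lincomb a (insert (monomial F u) (monomial F ` S)) =
      a (monomial F u) \<odot>\<^bsub>A\<^esub> monomial F u \<oplus>\<^bsub>A\<^esub> alg.lincomb a (monomial F ` S)"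
    using insert assms(3)
    by (intro alg.lincomb_insert2) (auto simp: monomial_carrier inj_image_mem_iff[OF inj_monomial])
  also have "\<dots> = (\<lambda>w. if w \<in> insert u S then a (monomial F w) else \<zero>)"
    using insert assms(3) by (auto simp: fun_eq_iff add_A smult_A) (auto simp: monomial_def)
  finally show ?case by simp
qed

lemma in_span_monomials:
  assumes "x \<in> carrier A"
  shows "x \<in> alg.span (monomial F ` {w. x w \<noteq> \<zero>})"
proof -
  let ?S = "{w. x w \<noteq> \<zero>}" and ?a = "\<lambda>v. x (inv_into UNIV (monomial F) v)"
  have S: "finite ?S" "?S \<subseteq> L" using assms by (auto simp: carrier_A)
  have a: "\<And>v. ?a v \<in> carrier F" using assms by (simp add: value_closed)
  have "alg.lincomb ?a (monomial F ` ?S) = x"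
    unfolding lincomb_monomials[OF S a] by (auto simp: fun_eq_iff inv_f_f[OF inj_monomial])
  moreover have "finite (monomial F ` ?S)" "?a \<in> monomial F ` ?S \<rightarrow> carrier F"
    using S(1) a by auto
  ultimately show ?thesis
    unfolding alg.span_def
    by (intro CollectI exI[of _ ?a] exI[of _ "monomial F ` ?S"]) auto
qed

definition short :: "nat \<Rightarrow> ('b list \<Rightarrow> 'a) set" where
  "short n = {x \<in> carrier A. \<forall>w. x w \<noteq> \<zero> \<longrightarrow> length w \<le> n}"

lemma short_subspace: "subspace F (short n) A"
proof -
  have "submodule F (short n) A"
    unfolding submodule_def
  proof (intro conjI allI impI)
    show "module F A" by (rule alg.module_axioms)
    show "\<zero>\<^bsub>A\<^esub> \<in> short n" using alg.M.zero_closed by (simp add: short_def zero_A)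
  next
    fix v w assume *: "v \<in> short n" "w \<in> short n"
    have "length u \<le> n" if "v u \<oplus> w u \<noteq> \<zero>" for u
    proof -
      have "v u \<noteq> \<zero> \<or> w u \<noteq> \<zero>" using that by auto
      then show ?thesis using * by (auto simp: short_def)
    qed
    then show "v \<oplus>\<^bsub>A\<^esub> w \<in> short n"
      using * add_closed_A[of v w] by (simp add: short_def add_A)
  next
    fix c v assume *: "c \<in> carrier F" "v \<in> short n"
    have "length u \<le> n" if "c \<otimes> v u \<noteq> \<zero>" for u
    proof -
      have "v u \<noteq> \<zero>" using that *(1) by auto
      then show ?thesis using *(2) by (simp add: short_def)
    qed
    then show "c \<odot>\<^bsub>A\<^esub> v \<in> short n"
      using * smult_closed_A[of c v] by (simp add: short_def smult_A)
  qed (auto simp: short_def)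
  then show ?thesis by (simp add: subspace_def is_vectorspace)
qed

lemma short_mono: "m \<le> n \<Longrightarrow> short m \<subseteq> short n"
  by (force simp: short_def)

lemma short_mult:
  assumes "x \<in> short m" "y \<in> short n"
  shows "x \<otimes>\<^bsub>A\<^esub> y \<in> short (m + n)"
proof -
  have xy: "x \<in> carrier A" "y \<in> carrier A" using assms by (auto simp: short_def)
  then show ?thesis
    using assms mult_support[OF xy] mult_closed[OF xy]
    unfolding short_def by (fastforce intro: add_mono)
qed

lemma dim_short:
  assumes fin: "finite {w \<in> L. length w \<le> n}"
  shows "vectorspace.fin_dim F (alg.vs (short n))"
    and "vectorspace.dim F (alg.vs (short n)) = card {w \<in> L. length w \<le> n}"
proof -
  let ?W = "{w \<in> L. length w \<le> n}"
  let ?B = "monomial F ` ?W"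
  interpret K: vectorspace F "alg.vs (short n)"
    by (rule alg.subspace_is_vs[OF short_subspace])
  have B: "?B \<subseteq> short n" by (auto simp: short_def monomial_carrier monomial_def split: if_splits)
  have finB: "finite ?B" using fin by simp
  have Bc: "?B \<subseteq> carrier A" by (auto simp: monomial_carrier)
  note nd = alg.span_li_not_depend[OF B alg.is_module[OF short_subspace]]
  have "short n \<subseteq> alg.span ?B"
  proof
    fix x assume x: "x \<in> short n"
    then have xc: "x \<in> carrier A" by (simp add: short_def)
    have "{w. x w \<noteq> \<zero>} \<subseteq> ?W" using x by (auto simp: short_def carrier_A)
    then have "alg.span (monomial F ` {w. x w \<noteq> \<zero>}) \<subseteq> alg.span ?B"
      by (intro alg.span_is_monotone image_mono)
    then show "x \<in> alg.span ?B" using in_span_monomials[OF xc] by blast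
  qed
  moreover have "alg.span ?B \<subseteq> short n"
    by (rule alg.span_subset_subspace[OF B short_subspace])
  ultimately have gen: "K.span ?B = short n" using nd(1) by simp
  have "alg.lin_indpt ?B"
  proof (rule alg.finite_lin_indpt2[OF finB Bc])
    fix a assume a: "a \<in> ?B \<rightarrow> carrier F" and z: "alg.lincomb a ?B = \<zero>\<^bsub>A\<^esub>"
    let ?a = "\<lambda>v. if v \<in> ?B then a v else \<zero>"
    have "alg.lincomb ?a ?B = alg.lincomb a ?B"
      using a Bc finB by (intro alg.lincomb_cong) auto
    moreover have "alg.lincomb ?a ?B = (\<lambda>w. if w \<in> ?W then ?a (monomial F w) else \<zero>)"
      using a fin by (intro lincomb_monomials) auto
    ultimately have "(\<lambda>w. if w \<in> ?W then ?a (monomial F w) else \<zero>) = (\<lambda>w. \<zero>)"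
      using z by (simp only: zero_A)
    then have "(if w \<in> ?W then ?a (monomial F w) else \<zero>) = \<zero>" for w by (rule fun_cong)
    then have "a (monomial F w) = \<zero>" if "w \<in> ?W" for w
      using that by (metis (no_types, lifting) imageI)
    then show "\<forall>v\<in>?B. a v = \<zero>" by blast
  qed
  then have "K.basis ?B" using nd(2) gen B by (simp add: K.basis_def)
  then show "K.fin_dim" "K.dim = card ?W"
    using K.dim_basis[OF finB] finB card_image[OF inj_on_subset[OF inj_monomial subset_UNIV], of ?W]
    by (auto simp: K.fin_dim_def K.basis_def)
qed

text \<open>
  If the words of length at most one lie in the \<open>c\<close>-th step of the filtration, a word of length
  \<open>l\<close>, being a product of \<open>l\<close> letters, lies in step \<open>c * l\<close>.
\<close>

lemma monomial_in_filtration: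
  assumes V: "V \<subseteq> carrier A"
    and letters: "monomial F ` {w \<in> L. length w \<le> 1} \<subseteq> alg.filtration V c"
    and "u \<in> L"
  shows "monomial F u \<in> alg.filtration V (c * length u)"
  using assms(3)
proof (induction u)
  case Nil
  show ?case
    using alg.one_in_subspace_power_0 alg.subspace_power_subset_filtration[OF V, of 0 0]
    by (auto simp: one_A)
next
  case (Cons b u)
  then have "[b] \<in> L" "u \<in> L" using in_L_factors[of "[b]" u] by auto
  then have "monomial F [b] \<otimes>\<^bsub>A\<^esub> monomial F u \<in> alg.filtration V (c + c * length u)"
    using letters Cons.IH by (intro alg.filtration_mult[OF V]) auto
  then show ?case using monomial_mult[of "[b]" u] Cons.prems by simp
qed

lemma finitely_generated:
  assumes "finite {w \<in> L. length w \<le> 1}"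
  shows "alg.finitely_generated"
proof -
  let ?S = "monomial F ` {w \<in> L. length w \<le> 1}"
  have "B = carrier A" if B: "alg.unital_subalgebra B" "?S \<subseteq> B" for B
  proof
    have sub: "subspace F B A" and one: "\<one>\<^bsub>A\<^esub> \<in> B"
      and mult: "\<And>x y. x \<in> B \<Longrightarrow> y \<in> B \<Longrightarrow> x \<otimes>\<^bsub>A\<^esub> y \<in> B"
      using B(1) by (auto simp: alg.unital_subalgebra_def)
    show "B \<subseteq> carrier A" by (rule alg.subspace_subset[OF sub])
    have mono: "monomial F u \<in> B" if "u \<in> L" for u
      using that
    proof (induction u)
      case Nil
      show ?case using one by (simp add: one_A)
    next
      case (Cons b u)
      then have "[b] \<in> L" "u \<in> L" using in_L_factors[of "[b]" u] by auto
      then have "monomial F [b] \<otimes>\<^bsub>A\<^esub> monomial F u \<in> B"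
        using B(2) Cons.IH by (intro mult) auto
      then show ?case using monomial_mult[of "[b]" u] Cons.prems by simp
    qed
    show "carrier A \<subseteq> B"
    proof
      fix x assume x: "x \<in> carrier A"
      then have "monomial F ` {w. x w \<noteq> \<zero>} \<subseteq> B" using mono by (auto simp: carrier_A)
      then show "x \<in> B"
        using in_span_monomials[OF x] alg.span_subset_subspace[OF _ sub] by blast
    qed
  qed
  then have "alg.generates_algebra ?S"
    by (auto simp: alg.generates_algebra_def monomial_carrier)
  then show ?thesis using assms unfolding alg.finitely_generated_def by blast
qed

lemma filtration_subset_short:
  assumes V: "V \<subseteq> short c"
  shows "alg.filtration V n \<subseteq> short (c * n)"
proof -
  have Vc: "V \<subseteq> carrier A" using V by (auto simp: short_def)
  have pow: "alg.subspace_power V i \<subseteq> short (c * i)" for i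
  proof (induction i)
    case 0
    have "{\<one>\<^bsub>A\<^esub>} \<subseteq> short 0"
      using alg.A.one_closed by (auto simp: short_def one_A monomial_def split: if_splits)
    then show ?case by (simp add: alg.span_subset_subspace short_subspace)
  next
    case (Suc i)
    have "{x \<otimes>\<^bsub>A\<^esub> y |x y. x \<in> alg.subspace_power V i \<and> y \<in> V} \<subseteq> short (c * Suc i)"
    proof clarify
      fix x y assume "x \<in> alg.subspace_power V i" "y \<in> V"
      then have "x \<otimes>\<^bsub>A\<^esub> y \<in> short (c * i + c)" using Suc V by (intro short_mult) auto
      then show "x \<otimes>\<^bsub>A\<^esub> y \<in> short (c * Suc i)" by (simp add: add.commute)
    qed
    then show ?case
      by (simp add: alg.subspace_prod_def alg.span_subset_subspace short_subspace)
  qed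
  have "alg.subspace_power V i \<subseteq> short (c * n)" if "i \<le> n" for i
    using pow[of i] short_mono[of "c * i" "c * n"] that by auto
  then show ?thesis using alg.filtration_minimal[OF Vc short_subspace] by blast
qed

text \<open>
  A finite spanning set involves only finitely many words, and \<open>c\<close> bounds their lengths.
\<close>

lemma fin_dim_subset_short:
  assumes V: "subspace F V A" "vectorspace.fin_dim F (alg.vs V)"
  shows "\<exists>c\<ge>1. V \<subseteq> short c"
proof -
  interpret V: vectorspace F "alg.vs V" by (rule alg.subspace_is_vs[OF V(1)])
  obtain B where B: "finite B" "B \<subseteq> V" "V.span B = V"
    using V(2) by (auto simp: V.fin_dim_def)
  have Bc: "B \<subseteq> carrier A" using B(2) alg.subspace_subset[OF V(1)] by blast
  let ?N = "\<Union>x\<in>B. length ` {w. x w \<noteq> \<zero>}"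
  have fin: "finite ?N" using B(1) Bc by (auto simp: carrier_A)
  define c where "c = Max (insert 1 ?N)"
  have "1 \<le> c" using fin by (simp add: c_def)
  have "length w \<le> c" if "x \<in> B" "x w \<noteq> \<zero>" for x w
    unfolding c_def using fin that by (intro Max_ge) auto
  then have "B \<subseteq> short c" using Bc by (auto simp: short_def)
  then have "alg.span B \<subseteq> short c" by (rule alg.span_subset_subspace[OF _ short_subspace])
  moreover have "alg.span B = V"
    using alg.span_li_not_depend(1)[OF B(2) alg.is_module[OF V(1)]] B(3) by simp
  ultimately show ?thesis using \<open>1 \<le> c\<close> by blast
qed

text \<open>
  The filtration of any generating subspace and the filtration by word length are cofinal in each
  other up to a linear change of the index; comparing dimensions gives both inequalities.
\<close>

lemma growth_bounds:
  assumes fin: "\<And>n. finite {w \<in> L. length w \<le> n}" and V: "alg.generating_subspace V"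
  shows "\<exists>c\<ge>1. \<forall>n. alg.growth V n \<le> card {w \<in> L. length w \<le> c * n}"
    and "\<exists>c\<ge>1. \<forall>n. card {w \<in> L. length w \<le> n} \<le> alg.growth V (c * n)"
proof -
  have gen: "alg.generates_algebra V" and sub: "subspace F V A"
    and fd: "vectorspace.fin_dim F (alg.vs V)"
    using V by (auto simp: alg.generating_subspace_def)
  have Vc: "V \<subseteq> carrier A" by (rule alg.subspace_subset[OF sub])
  obtain c where c: "1 \<le> c" "V \<subseteq> short c" using fin_dim_subset_short[OF sub fd] by blast
  have up: "alg.filtration V n \<subseteq> short (c * n)" for n by (rule filtration_subset_short[OF c(2)])
  note filt = alg.filtration_subspace[OF Vc]
  have fdf: "vectorspace.fin_dim F (alg.vs (alg.filtration V n))" for n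
    by (rule alg.subspace_dim_mono(1)[OF filt short_subspace up dim_short(1)[OF fin]])
  have "alg.growth V n \<le> card {w \<in> L. length w \<le> c * n}" for n
    using alg.subspace_dim_mono(2)[OF filt short_subspace up dim_short(1)[OF fin]]
    unfolding alg.growth_def dim_short(2)[OF fin] .
  then show "\<exists>c\<ge>1. \<forall>n. alg.growth V n \<le> card {w \<in> L. length w \<le> c * n}" using c(1) by blast
  have "finite (monomial F ` {w \<in> L. length w \<le> 1})" using fin by blast
  moreover have "monomial F ` {w \<in> L. length w \<le> 1} \<subseteq> carrier A" by (auto simp: monomial_carrier)
  ultimately obtain d where d: "1 \<le> d" "monomial F ` {w \<in> L. length w \<le> 1} \<subseteq> alg.filtration V d"
    using alg.finite_subset_filtration[OF gen] by blast
  have low: "short n \<subseteq> alg.filtration V (d * n)" for n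
  proof
    fix x assume x: "x \<in> short n"
    then have xc: "x \<in> carrier A" by (simp add: short_def)
    have "monomial F ` {w. x w \<noteq> \<zero>} \<subseteq> alg.filtration V (d * n)"
    proof clarify
      fix w assume "x w \<noteq> \<zero>"
      then have "w \<in> L" "length w \<le> n" using x by (auto simp: short_def carrier_A)
      then show "monomial F w \<in> alg.filtration V (d * n)"
        using monomial_in_filtration[OF Vc d(2)]
          alg.filtration_mono[OF Vc, of "d * length w" "d * n"] by auto
    qed
    then show "x \<in> alg.filtration V (d * n)"
      using in_span_monomials[OF xc] alg.span_subset_subspace[OF _ filt] by blast
  qed
  have "card {w \<in> L. length w \<le> n} \<le> alg.growth V (d * n)" for n
    using alg.subspace_dim_mono(2)[OF short_subspace filt low fdf]
    unfolding alg.growth_def dim_short(2)[OF fin] .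
  then show "\<exists>c\<ge>1. \<forall>n. card {w \<in> L. length w \<le> n} \<le> alg.growth V (c * n)" using d(1) by blast
qed

end

theorem proposition3p1:
  fixes F :: "('a, 'm) ring_scheme" and f :: "nat \<Rightarrow> nat"
  assumes "field F"
    and "pos_valued f" and "increasing f" and "submultiplicative f"
  shows "\<exists>A :: 'a word_algebra.
           assoc_algebra F A \<and> assoc_algebra.finitely_generated F A \<and>
           (\<forall>V. assoc_algebra.generating_subspace F A V \<longrightarrow>
              f \<preceq> assoc_algebra.growth F A V \<and>
              assoc_algebra.growth F A V \<preceq> (\<lambda>n. n * f n))"
proof -
  interpret G: submultiplicative_growth f
    using assms(2-4)
    by unfold_locales (auto simp: pos_valued_def increasing_def submultiplicative_def)
  have "[] \<in> G.lang"
    by (auto simp: G.lang_eq sparse_words_def intro!: image_eqI[of _ _ 0])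
  then interpret M: monomial_algebra_over F G.lang "monomial_algebra F G.lang"
    using assms(1) factor_closed_pulse_language
    by (auto simp: monomial_algebra_over_def monomial_algebra_over_axioms_def G.lang_def)
  have fin: "finite {w \<in> G.lang. length w \<le> n}" for n
    using G.finite_words_upto by (simp add: G.words_upto_def)
  have "f \<preceq> M.alg.growth V \<and> M.alg.growth V \<preceq> (\<lambda>n. n * f n)"
    if V: "M.alg.generating_subspace V" for V
  proof
    obtain c where c: "1 \<le> c" "\<And>n. card (G.words_upto n) \<le> M.alg.growth V (c * n)"
      using M.growth_bounds(2)[OF fin V] unfolding G.words_upto_def by blast
    have "f n \<le> M.alg.growth V (c * (10 * f 1) * n)" if "1 \<le> n" for n
      using G.f_le_card_words[OF that] c(2)[of "10 * f 1 * n"] by (simp add: mult.assoc)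
    moreover have "1 \<le> c * (10 * f 1)" using c(1) G.f1_ge_2 by simp
    ultimately show "f \<preceq> M.alg.growth V" unfolding growth_le_def by blast
    obtain d where d: "1 \<le> d" "\<And>n. M.alg.growth V n \<le> card (G.words_upto (d * n))"
      using M.growth_bounds(1)[OF fin V] unfolding G.words_upto_def by blast
    \<comment> \<open>The constant of the counting estimate, to be absorbed into the scaling constant \<open>C\<close>.\<close>
    define E where "E = 5 + 4000 * f 1 ^ 3"
    define C where "C = 40 * E * d"
    have "M.alg.growth V n \<le> C * n * f (C * n)" if n: "1 \<le> n" for n
    proof -
      have dn: "1 \<le> d * n" using d(1) n by simp
      have "M.alg.growth V n \<le> E * (d * n) * f (40 * (d * n))"
        using d(2)[of n] G.card_words_upto_le[OF dn] unfolding E_def by linarith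
      also have "\<dots> \<le> C * n * f (C * n)"
      proof (rule mult_le_mono)
        show "E * (d * n) \<le> C * n" by (simp add: C_def)
        have "40 * (d * n) * 1 \<le> 40 * (d * n) * E" by (rule mult_le_mono2) (simp add: E_def)
        then have "40 * (d * n) \<le> C * n" by (simp add: C_def mult_ac)
        then show "f (40 * (d * n)) \<le> f (C * n)" using dn by (intro G.f_mono) auto
      qed
      finally show ?thesis .
    qed
    moreover have "1 \<le> C" using d(1) by (simp add: C_def E_def)
    ultimately show "M.alg.growth V \<preceq> (\<lambda>n. n * f n)" unfolding growth_le_def by blast
  qed
  then show ?thesis using M.is_assoc_algebra M.finitely_generated[OF fin] by blast
qed

end
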